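(* Let $p$ be an odd prime, $q$ a power of $p$, $\xi$ a generator of the cyclic group $\mathbb F_q^*$, $\ell$ an odd prime with $\ell\neq p$ and $\gcd(\ell,q-1)=1$, and $m,n$ positive integers. Let $\lambda\in\mathbb F_q^*$ and let $C$ be a $\lambda$-constacyclic code of length $2\ell^mp^n$ over $\mathbb F_q$. Then one of the following holds. (A) $\lambda\in\langle\xi^2\rangle$. Then there is $a\in\mathbb F_q^*$ with $a^{2\ell^mp^n}\lambda=1$, and $$C=\Big\langle \prod_{i=0}^{e}\hat M_{\rho_i}(aX)^{\varepsilon_i}\hat M_{\rho_i}(-aX)^{\epsilon_i}\Big\rangle$$ for some integers $0\le \varepsilon_i,\epsilon_i\le p^n$, $i=0,1,\dots,e$. (B) $\lambda\notin\langle\xi^2\rangle$. Then there is $b\in\mathbb F_q^*$ with $b^{2\ell^mp^n}\lambda=\xi^{p^n}$, and: (B1) if $f=\mathrm{ord}_\ell(q)$ is odd, then $$C=\Big\langle \prod_{i=0}^{e}\hat S_i(bX)^{\varepsilon_i}\Big\rangle$$ for some integers $0\le\varepsilon_i\le p^n$, $i=0,\dots,e$, where $S_i(X)=\hat M_{\rho_i}(\beta_1X)\hat M_{\rho_i}(-\beta_1X)$; (B2) if $f=\mathrm{ord}_\ell(q)$ is even, then $$C=\Big\langle \hat P(bX)^{\varepsilon}\prod_{i=1}^{e}\hat Q_i(bX)^{\varepsilon_i}\hat R_i(bX)^{\epsilon_i}\Big\rangle$$ for some integers $0\le \varepsilon,\varepsilon_i,\epsilon_i\le p^n$, $i=1,\dots,e$,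 where $P(X)=(X-\beta_1^{-1})(X+\beta_1^{-1})$, $Q_i(X)=\hat N_{\rho_i}(\beta_1X)\hat N_{\rho_iq}(-\beta_1X)$ and $R_i(X)=\hat N_{\rho_iq}(\beta_1X)\hat N_{\rho_i}(-\beta_1X)$.
   Context: For $\mu\in\mathbb F_q^*$, a $\mu$-constacyclic code of length $N$ over $\mathbb F_q$ is a linear subspace of $\mathbb F_q^N$ closed under $(c_0,\dots,c_{N-1})\mapsto(\mu c_{N-1},c_0,\dots,c_{N-2})$; such codes are identified with ideals of $\mathbb F_q[X]/\langle X^N-\mu\rangle$, and $\langle g(X)\rangle$ denotes the ideal generated by the image of $g(X)$. For a nonzero polynomial $h$ with leading coefficient $c$, $\hat h=c^{-1}h$ (the monic associate). $\langle\xi^k\rangle$ denotes the subgroup of $\mathbb F_q^*$ generated by $\xi^k$. For an integer $t$, the $q$-cyclotomic coset of $t$ modulo $\ell^m$ is $C_t=\{tq^i \bmod \ell^m: i\ge 0\}$; let $\rho_0=0,\rho_1,\dots,\rho_e$ be representatives of all the distinct $q$-cyclotomic cosets modulo $\ell^m$. Let $\eta$ be a primitive $\ell^m$-th root of unity in an extension field of $\mathbb F_q$ and $M_t(X)=\prod_{s\in C_t}(X-\eta^s)$ (the minimal polynomial of $\eta^t$ over $\mathbb F_q$). When $f=\mathrm{ord}_\ell(q)$ is even, for an integer $t$ let $D_t=\{tq^{2i}\bmod \ell^m:i\ge0\}$ be its $q^2$-cyclotomic coset; then for $1\le k\le e$, $C_{\rho_k}$ is the disjoint union of $D_{\rho_k}$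 and $D_{\rho_kq}$, and $N_t(X)=\prod_{s\in D_t}(X-\eta^s)$. Let $\alpha_1\in\mathbb F_{q^2}$ with $\alpha_1^2=\xi$, and let $\beta_1$ be the unique primitive $2(q-1)$-th root of unity in $\mathbb F_{q^2}$ with $\beta_1^{\ell^m}\alpha_1=1$. *)

theory Defs
  imports "HOL-Number_Theory.Number_Theory" "HOL-Computational_Algebra.Polynomial" "HOL-Library.Cardinality"
begin

definition constacyclic_shift :: "'a::field \<Rightarrow> 'a list \<Rightarrow> 'a list" where
  "constacyclic_shift \<mu> c = (\<mu> * last c) # butlast c"

definition constacyclic_code :: "'a::field \<Rightarrow> nat \<Rightarrow> 'a list set \<Rightarrow> bool" where
  "constacyclic_code \<mu> N C \<longleftrightarrow>
     (\<forall>c\<in>C. length c = N) \<and> replicate N 0 \<in> C \<and>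
     (\<forall>c\<in>C. \<forall>d\<in>C. map2 (+) c d \<in> C) \<and>
     (\<forall>a. \<forall>c\<in>C. map (\<lambda>x. a * x) c \<in> C) \<and>
     (\<forall>c\<in>C. constacyclic_shift \<mu> c \<in> C)"

definition poly_vec :: "nat \<Rightarrow> 'a::zero poly \<Rightarrow> 'a list" where
  "poly_vec N c = map (coeff c) [0..<N]"

text \<open>The code corresponding to the ideal generated by g in F[X]/<X^N - mu>.\<close>
definition gen_code :: "'a::field \<Rightarrow> nat \<Rightarrow> 'a poly \<Rightarrow> 'a list set" where
  "gen_code \<mu> N g = {poly_vec N ((g * h) mod (monom 1 N - [:\<mu>:])) | h. True}"

definition monic_assoc :: "'a::field poly \<Rightarrow> 'a poly" where
  "monic_assoc h = smult (inverse (lead_coeff h)) h"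

definition scale_var :: "'a::comm_ring_1 poly \<Rightarrow> 'a \<Rightarrow> 'a poly" where
  "scale_var h c = h \<circ>\<^sub>p [:0, c:]"

definition cyc_coset :: "nat \<Rightarrow> nat \<Rightarrow> nat \<Rightarrow> nat set" where
  "cyc_coset q L t = {t * q ^ i mod L | i. True}"

definition Mpoly :: "nat \<Rightarrow> nat \<Rightarrow> 'b::field \<Rightarrow> nat \<Rightarrow> 'b poly" where
  "Mpoly q L \<eta> t = (\<Prod>s\<in>cyc_coset q L t. [:- (\<eta> ^ s), 1:])"

definition Npoly :: "nat \<Rightarrow> nat \<Rightarrow> 'b::field \<Rightarrow> nat \<Rightarrow> 'b poly" where
  "Npoly q L \<eta> t = (\<Prod>s\<in>cyc_coset (q^2) L t. [:- (\<eta> ^ s), 1:])"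

text \<open>C is generated (as an ideal) by an F_q-polynomial whose image in the extension is G.\<close>
definition gen_by :: "('a::field \<Rightarrow> 'b::field) \<Rightarrow> 'a \<Rightarrow> nat \<Rightarrow> 'a list set \<Rightarrow> 'b poly \<Rightarrow> bool" where
  "gen_by \<iota> \<mu> N C G \<longleftrightarrow> (\<exists>g. map_poly \<iota> g = G \<and> C = gen_code \<mu> N g)"

definition prim_root :: "'b::field \<Rightarrow> nat \<Rightarrow> bool" where
  "prim_root z k \<longleftrightarrow> z ^ k = 1 \<and> (\<forall>j. 0 < j \<and> j < k \<longrightarrow> z ^ j \<noteq> 1)"

end

theory Submission
  imports Defs
begin

text \<open>
  A constacyclic code is generated by a monic divisor \<open>g\<close> of \<open>X\<^sup>N - \<lambda>\<close>. Over the extension field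
  \<open>X\<^sup>N - \<lambda>\<close> is the \<open>p\<^sup>n\<close>-th power of the product of the linear factors at the \<open>2 L\<close> distinct
  elements \<open>\<plusminus>\<eta>\<^sup>s / c\<close>, where \<open>c = a\<close> in case (A) and \<open>c = \<beta>\<^sub>1 b\<close> in case (B). Because \<open>g\<close> has
  coefficients in the small field, the multiplicity of its roots is constant on the orbits of
  \<open>x \<mapsto> x\<^sup>q\<close>, so \<open>g\<close> is a product of powers of orbit polynomials. In case (A) the Frobenius map
  fixes \<open>c\<close> and the orbits are the \<open>q\<close>-cyclotomic cosets for either sign; in case (B) it negates
  \<open>c\<close>, and the parity of \<open>ord l q\<close> decides whether both signs lie in one orbit.
\<close>

subsection \<open>Polynomials and their roots\<close>

lemma map_poly_hom_mult:
  fixes f :: "'a::comm_ring_1 \<Rightarrow> 'b::comm_ring_1"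
  assumes zero: "f 0 = 0" and add: "\<And>x y. f (x + y) = f x + f y"
    and mult: "\<And>x y. f (x * y) = f x * f y"
  shows "map_poly f (g * h) = map_poly f g * map_poly f h"
proof (rule poly_eqI)
  fix k
  have sum: "f (sum u A) = (\<Sum>x\<in>A. f (u x))" for u and A :: "nat set"
    by (induction A rule: infinite_finite_induct) (simp_all add: zero add)
  show "coeff (map_poly f (g * h)) k = coeff (map_poly f g * map_poly f h) k"
    by (simp add: coeff_map_poly zero coeff_mult sum mult)
qed

lemma map_poly_hom_power:
  fixes f :: "'a::comm_ring_1 \<Rightarrow> 'b::comm_ring_1"
  assumes "f 0 = 0" "f 1 = 1" "\<And>x y. f (x + y) = f x + f y" "\<And>x y. f (x * y) = f x * f y"
  shows "map_poly f (g ^ k) = map_poly f g ^ k"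
  by (induction k) (simp_all add: map_poly_hom_mult assms)

lemma poly_map_poly_hom:
  fixes f :: "'a::comm_ring_1 \<Rightarrow> 'b::comm_ring_1"
  assumes "f 0 = 0" "\<And>x y. f (x + y) = f x + f y" "\<And>x y. f (x * y) = f x * f y"
  shows "poly (map_poly f g) (f x) = f (poly g x)"
  by (induction g) (simp_all add: map_poly_pCons assms)

text \<open>A factorization of \<open>g\<close> into a power of X - x and a cofactor not vanishing
  at \<open>x\<close> is carried by \<open>f\<close> to one of the same shape. It is later applied
  to the q-th power map of the extension field.\<close>

lemma order_map_poly_hom:
  fixes f :: "'a::field \<Rightarrow> 'b::field"
  assumes zero: "f 0 = 0" and one: "f 1 = 1" and add: "\<And>x y. f (x + y) = f x + f y"
    and mult: "\<And>x y. f (x * y) = f x * f y"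
    and nz: "\<And>x. x \<noteq> 0 \<Longrightarrow> f x \<noteq> 0" and g: "g \<noteq> 0"
  shows "order (f x) (map_poly f g) = order x g"
proof -
  obtain h where h: "g = [:- x, 1:] ^ order x g * h" and "\<not> [:- x, 1:] dvd h"
    using order_decomp[OF g] by blast
  then have "poly h x \<noteq> 0"
    by (simp add: poly_eq_0_iff_dvd)
  then have hx: "poly (map_poly f h) (f x) \<noteq> 0"
    using nz by (simp add: poly_map_poly_hom zero add mult)
  have "f (- x) = - f x"
    using add[of x "- x"] by (simp add: zero eq_neg_iff_add_eq_0 add.commute)
  then have lin: "map_poly f [:- x, 1:] = [:- f x, 1:]"
    by (simp add: map_poly_pCons zero one)
  have "map_poly f g = [:- f x, 1:] ^ order x g * map_poly f h"
    by (subst h) (simp add: map_poly_hom_mult map_poly_hom_power zero one add mult lin)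
  moreover have "map_poly f h \<noteq> 0"
    using hx by auto
  ultimately show ?thesis
    using hx by (simp add: order_mult order_power_n_n order_0I)
qed

section \<open>Monic polynomials given by their root sets\<close>

definition root_poly :: "'b::field set \<Rightarrow> 'b poly" where
  "root_poly R = (\<Prod>r\<in>R. [:- r, 1:])"

lemma lead_coeff_root_poly [simp]: "lead_coeff (root_poly R) = 1"
  by (simp add: root_poly_def lead_coeff_prod)

lemma root_poly_nonzero [simp]: "root_poly R \<noteq> 0"
  by (cases "finite R") (simp_all add: root_poly_def)

lemma degree_root_poly: "finite R \<Longrightarrow> degree (root_poly R) = card R"
  by (simp add: root_poly_def degree_prod_sum_eq)

lemma root_poly_union:
  "finite R \<Longrightarrow> finite S \<Longrightarrow> R \<inter> S = {} \<Longrightarrow> root_poly (R \<union> S) = root_poly R * root_poly S"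
  by (simp add: root_poly_def prod.union_disjoint)

lemma root_poly_dvd:
  assumes "finite R" "\<And>r. r \<in> R \<Longrightarrow> poly g r = 0"
  shows "root_poly R dvd g"
  using assms
proof (induction R arbitrary: g rule: finite_induct)
  case empty
  then show ?case by (simp add: root_poly_def)
next
  case (insert r R)
  then obtain h where h: "g = [:- r, 1:] * h"
    by (metis dvdE insertI1 poly_eq_0_iff_dvd)
  have "poly h s = 0" if "s \<in> R" for s
  proof -
    have "s \<noteq> r" using that insert by auto
    then show ?thesis using insert.prems[of s] that by (simp add: h)
  qed
  then have "root_poly R dvd h"
    using insert by blast
  then show ?case
    unfolding h root_poly_def prod.insert[OF insert.hyps(1,2)] by (rule mult_dvd_mono[OF dvd_refl])
qed

lemma monic_assoc_scale_mult:
  "monic_assoc (scale_var (g * h) c) = monic_assoc (scale_var g c) * monic_assoc (scale_var h c)"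
  by (simp add: monic_assoc_def scale_var_def pcompose_mult lead_coeff_mult mult_ac)

text \<open>Each factor becomes cX - r = c(X - r/c), and the collected power of \<open>c\<close> is
  the leading coefficient that \<open>monic_assoc\<close> removes. This turns the hats in the
  theorem into root sets.\<close>

lemma monic_assoc_scale_root_poly:
  assumes "finite R" "c \<noteq> 0"
  shows "monic_assoc (scale_var (root_poly R) c) = root_poly ((\<lambda>r. r / c) ` R)"
proof -
  have inj: "inj_on (\<lambda>r. r / c) R"
    using assms by (simp add: inj_on_def)
  have lin: "[:- r, c:] = smult c [:- (r / c), 1:]" for r
    using assms by simp
  have "scale_var (root_poly R) c = (\<Prod>r\<in>R. [:- r, c:])"
    by (simp add: scale_var_def root_poly_def pcompose_prod pcompose_pCons)
  also have "\<dots> = smult (c ^ card R) (\<Prod>r\<in>R. [:- (r / c), 1:])"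
    unfolding lin by (simp only: prod_smult prod_constant)
  also have "(\<Prod>r\<in>R. [:- (r / c), 1:]) = root_poly ((\<lambda>r. r / c) ` R)"
    by (simp add: root_poly_def prod.reindex[OF inj])
  finally show ?thesis
    using assms by (simp add: monic_assoc_def lead_coeff_smult)
qed

text \<open>The powers of X - r are cancelled one at a time: in (X - r) s = g t the factor t must
  vanish at \<open>r\<close>, since \<open>g\<close> does not.\<close>

lemma dvd_linear_power_mult_cancel:
  fixes g h :: "'b::field poly"
  assumes "poly g r \<noteq> 0" "g dvd [:- r, 1:] ^ k * h"
  shows "g dvd h"
  using assms(2)
proof (induction k)
  case (Suc k)
  then obtain t where t: "[:- r, 1:] * ([:- r, 1:] ^ k * h) = g * t"
    unfolding power_Suc mult.assoc by (elim dvdE)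
  have "poly (g * t) r = 0"
    by (subst t[symmetric]) simp
  then obtain u where "t = [:- r, 1:] * u"
    using assms(1) by (auto simp: poly_eq_0_iff_dvd)
  then have "[:- r, 1:] * ([:- r, 1:] ^ k * h) = [:- r, 1:] * (g * u)"
    using t by (simp only: mult.left_commute)
  then have "[:- r, 1:] ^ k * h = g * u"
    by (subst (asm) mult_cancel_left) auto
  then show ?case
    using Suc.IH by simp
qed simp

lemma linear_power_dvd_cancel:
  fixes g h :: "'b::field poly"
  assumes "poly g r \<noteq> 0" "[:- r, 1:] ^ k dvd g * h"
  shows "[:- r, 1:] ^ k dvd h"
proof (cases "h = 0")
  case False
  moreover have "g \<noteq> 0"
    using assms(1) by auto
  ultimately show ?thesis
    using assms by (auto simp: order_divides order_mult order_0I)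
qed simp

lemma dvd_prod_linear_powers_no_roots:
  fixes g :: "'b::field poly"
  assumes "finite U" "g dvd (\<Prod>r\<in>U. [:- r, 1:] ^ k)" "\<And>r. r \<in> U \<Longrightarrow> poly g r \<noteq> 0"
  shows "g dvd 1"
  using assms by (induction U rule: finite_induct) (auto dest: dvd_linear_power_mult_cancel)

text \<open>The product over \<open>U\<close> does not vanish at a new point \<open>r\<close>, so
  the power of X - r dividing \<open>g\<close> must divide the cofactor.\<close>

lemma prod_order_dvd:
  fixes g :: "'b::field poly"
  assumes "finite U" "g \<noteq> 0"
  shows "(\<Prod>r\<in>U. [:- r, 1:] ^ order r g) dvd g"
  using assms(1)
proof (induction U rule: finite_induct)
  case (insert r U)
  then obtain h where h: "g = (\<Prod>r\<in>U. [:- r, 1:] ^ order r g) * h"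
    by blast
  have "poly (\<Prod>r\<in>U. [:- r, 1:] ^ order r g) r \<noteq> 0"
    using insert by (auto simp: poly_prod poly_power)
  then have "[:- r, 1:] ^ order r g dvd h"
    by (rule linear_power_dvd_cancel) (simp only: h[symmetric] order_1)
  then have "[:- r, 1:] ^ order r g * (\<Prod>r\<in>U. [:- r, 1:] ^ order r g) dvd h * (\<Prod>r\<in>U. [:- r, 1:] ^ order r g)"
    by (intro mult_dvd_mono dvd_refl)
  then show ?case
    unfolding prod.insert[OF insert.hyps] by (simp only: mult.commute[of h] h[symmetric])
qed simp

text \<open>The cofactor of the product of local powers has no root in \<open>U\<close> but still
  divides a product of linear factors at points of \<open>U\<close>. Hence it is a unit, and being
  monic it is 1.\<close>

lemma monic_dvd_root_poly_power:
  assumes U: "finite U" and monic: "lead_coeff g = 1" and dvd: "g dvd root_poly U ^ k"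
  shows "g = (\<Prod>r\<in>U. [:- r, 1:] ^ order r g)"
proof -
  define h where "h = (\<Prod>r\<in>U. [:- r, 1:] ^ order r g)"
  have g: "g \<noteq> 0" using monic by auto
  then obtain t where t: "g = h * t"
    using prod_order_dvd[OF U] unfolding h_def by blast
  have "poly t r \<noteq> 0" if "r \<in> U" for r
  proof -
    have "[:- r, 1:] ^ order r g dvd h"
      unfolding h_def using U that by (rule dvd_prodI)
    then have "order r g \<le> order r h"
      using g t by (auto simp: order_divides)
    \<comment> \<open>The order of \<open>g\<close> at \<open>r\<close> is that of \<open>h\<close>
      plus that of \<open>t\<close>, and the order of \<open>h\<close> already reaches it.\<close>
    then have "order r t = 0"
      using g t order_mult[of h t r] by auto
    then show ?thesis
      using g t by (auto simp: order_eq_0_iff)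
  qed
  moreover have "t dvd (\<Prod>r\<in>U. [:- r, 1:] ^ k)"
    using dvd_trans[OF dvd_triv_right[of t h, folded t] dvd] by (simp add: root_poly_def prod_power_distrib)
  ultimately have "t dvd 1"
    using dvd_prod_linear_powers_no_roots[OF U] by blast
  moreover have "lead_coeff h = 1"
    by (simp add: h_def lead_coeff_prod lead_coeff_power)
  then have "lead_coeff t = 1"
    using monic t by (simp add: lead_coeff_mult)
  ultimately have "t = 1"
    by (auto simp: is_unit_poly_iff)
  then show ?thesis
    using t h_def by simp
qed

subsection \<open>Constacyclic codes as ideals\<close>

lemma degree_monom_minus_const: "0 < N \<Longrightarrow> degree (monom 1 N - [:\<mu>:] :: 'a::field poly) = N"
  unfolding diff_conv_add_uminus by (subst degree_add_eq_left) (simp_all add: degree_monom_eq)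

text \<open>Multiplication by X creates at most one term of degree \<open>N\<close>. Subtracting
  that multiple of the modulus deletes it and adds \<open>\<mu>\<close> times its coefficient in
  degree 0, which is the constacyclic shift.\<close>

lemma X_mult_mod_monom_minus_const:
  fixes r :: "'a::field poly"
  assumes "0 < N" "degree r < N"
  shows "(pCons 0 r) mod (monom 1 N - [:\<mu>:]) =
           pCons 0 r - smult (coeff r (N - 1)) (monom 1 N - [:\<mu>:])" (is "_ mod ?M = ?s")
proof -
  have M: "degree ?M = N"
    using assms(1) by (rule degree_monom_minus_const)
  have "coeff ?s i = 0" if "i \<ge> N" for i
  proof (cases "i = N")
    case True
    then show ?thesis using assms by (simp add: coeff_pCons split: nat.splits)
  next
    case False
    then show ?thesis using assms that
      by (auto simp: coeff_pCons coeff_eq_0 split: nat.splits)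
  qed
  then have "degree ?s < N"
    using assms(1) by (intro degree_lessI) blast+
  then have "?s mod ?M = ?s"
    using M by (simp add: mod_poly_less)
  moreover have "pCons 0 r = ?s + [:coeff r (N - 1):] * ?M"
    by simp
  then have "pCons 0 r mod ?M = ?s mod ?M"
    using mod_mult_self1[of ?s "[:coeff r (N - 1):]" ?M] by (simp only:)
  ultimately show ?thesis by simp
qed

lemma poly_vec_add: "poly_vec N (g + h) = map2 (+) (poly_vec N g) (poly_vec N h)"
  by (simp add: poly_vec_def map2_map_map)

lemma poly_vec_smult: "poly_vec N (smult a g) = map (\<lambda>x. a * x) (poly_vec N g)"
  by (simp add: poly_vec_def)

lemma constacyclic_shift_poly_vec:
  fixes r :: "'a::field poly"
  assumes "0 < N" "degree r < N"
  shows "constacyclic_shift \<mu> (poly_vec N r) = poly_vec N (pCons 0 r mod (monom 1 N - [:\<mu>:]))"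
proof -
  obtain k where k: "N = Suc k" using assms by (cases N) auto
  show ?thesis
    unfolding X_mult_mod_monom_minus_const[OF assms]
  proof (rule nth_equalityI)
    fix i assume "i < length (constacyclic_shift \<mu> (poly_vec N r))"
    then have "i \<le> k" by (simp add: constacyclic_shift_def poly_vec_def k)
    then show "constacyclic_shift \<mu> (poly_vec N r) ! i =
        poly_vec N (pCons 0 r - smult (coeff r (N - 1)) (monom 1 N - [:\<mu>:])) ! i"
      by (auto simp: constacyclic_shift_def poly_vec_def k nth_Cons nth_append coeff_pCons less_Suc_eq
          split: nat.splits)
  qed (simp add: constacyclic_shift_def poly_vec_def k)
qed

text \<open>The polynomials whose residue lies in the code form an ideal \<open>I\<close>, closure
  under the shift being closure under multiplication by X. A monic element of least degree generates
  it.\<close>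

lemma constacyclic_code_generator:
  fixes C :: "'a::field list set"
  assumes code: "constacyclic_code \<mu> N C" and N: "0 < N"
  obtains g where "lead_coeff g = 1" "g dvd monom 1 N - [:\<mu>:]" "C = gen_code \<mu> N g"
proof -
  define M where "M = monom 1 N - [:\<mu>:]"
  define I where "I = {h. poly_vec N (h mod M) \<in> C}"
  have deg: "degree M = N"
    unfolding M_def using N by (rule degree_monom_minus_const)
  then have M0: "M \<noteq> 0" using N by auto
  have less: "degree (h mod M) < N" for h
    using degree_mod_less[OF M0, of h] deg N by auto
  have add: "g + h \<in> I" if "g \<in> I" "h \<in> I" for g h
    using that code by (simp add: I_def poly_mod_add_left poly_vec_add constacyclic_code_def)
  have smult: "smult a g \<in> I" if "g \<in> I" for a g
    using that code by (simp add: I_def mod_smult_left poly_vec_smult constacyclic_code_def)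
  \<comment> \<open>The shift lemma needs degree below \<open>N\<close>, so \<open>g\<close> is
    reduced first; the inner reduction then disappears modulo \<open>M\<close>.\<close>
  have shift: "pCons 0 g \<in> I" if "g \<in> I" for g
  proof -
    have "constacyclic_shift \<mu> (poly_vec N (g mod M)) \<in> C"
      using that code by (simp add: I_def constacyclic_code_def)
    then have "poly_vec N (pCons 0 (g mod M) mod M) \<in> C"
      unfolding constacyclic_shift_poly_vec[OF N less] by (simp only: M_def)
    moreover have X: "[:0, 1:] * h = pCons 0 h" for h :: "'a poly"
      by simp
    have "pCons 0 (g mod M) mod M = pCons 0 g mod M"
      using mod_mult_right_eq[of "[:0, 1:]" g M] by (simp only: X)
    ultimately show ?thesis by (simp add: I_def)
  qed
  have zero: "0 \<in> I"
  proof -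
    have "poly_vec N 0 = replicate N (0::'a)"
      by (rule nth_equalityI) (simp_all add: poly_vec_def)
    then show ?thesis using code by (simp add: I_def constacyclic_code_def)
  qed
  have mult: "g * h \<in> I" if "g \<in> I" for g h
  proof (induction h)
    case (pCons a h)
    then show ?case
      unfolding mult_pCons_right using that by (intro add smult shift)
  qed (use zero in simp)
  \<comment> \<open>The modulus has residue 0. Its membership supplies a nonzero element for the
    minimal choice and at the end makes \<open>g\<close> divide it.\<close>
  have MI: "M \<in> I"
    using zero unfolding I_def by simp
  obtain g0 where g0: "g0 \<in> I" "g0 \<noteq> 0"
    and min: "\<And>h. h \<in> I \<Longrightarrow> h \<noteq> 0 \<Longrightarrow> degree g0 \<le> degree h"
    using arg_min_nat_lemma[of "\<lambda>h. h \<in> I \<and> h \<noteq> 0" M degree] MI M0 by metis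
  define g where "g = smult (inverse (lead_coeff g0)) g0"
  have g: "g \<in> I" "lead_coeff g = 1"
    using g0 smult[OF g0(1)] by (simp_all add: g_def)
  have g_nz: "g \<noteq> 0" using g(2) by auto
  have g_dvd: "g dvd h" if "h \<in> I" for h
  proof -
    have "h mod g = h + smult (- 1) (g * (h div g))"
      using mult_div_mod_eq[of g h] by (simp add: algebra_simps)
    then have "h mod g \<in> I"
      using add[OF that smult[OF mult[OF g(1)]]] by metis
    moreover have "h mod g = 0 \<or> degree (h mod g) < degree g0"
      using degree_mod_less[OF g_nz, of h] g0 by (simp add: g_def)
    ultimately have "h mod g = 0"
      using min by fastforce
    then show ?thesis by (simp add: dvd_eq_mod_eq_0)
  qed
  have "C = gen_code \<mu> N g"
  proof (intro equalityI subsetI)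
    fix c assume c: "c \<in> C"
    then have len: "length c = N" using code by (simp add: constacyclic_code_def)
    have small: "degree (Poly c) < N"
    proof (rule degree_lessI)
      show "Poly c \<noteq> 0 \<or> 0 < N" using N by simp
      show "\<forall>k\<ge>N. coeff (Poly c) k = 0" by (simp add: len nth_default_beyond)
    qed
    then have "Poly c mod M = Poly c"
      using deg by (simp add: mod_poly_less)
    moreover have vec: "poly_vec N (Poly c) = c"
      by (rule nth_equalityI) (simp_all add: poly_vec_def len nth_default_nth)
    ultimately have "Poly c \<in> I" using c by (simp add: I_def)
    then obtain h where "Poly c = g * h" using g_dvd by blast
    then show "c \<in> gen_code \<mu> N g"
      using vec \<open>Poly c mod M = Poly c\<close> by (auto simp: gen_code_def M_def intro!: exI[of _ h])
  next
    fix c assume "c \<in> gen_code \<mu> N g"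
    then show "c \<in> C" using mult[OF g(1)] by (auto simp: gen_code_def I_def M_def)
  qed
  then show thesis using that g g_dvd[OF MI] by (simp add: M_def)
qed

subsection \<open>The Frobenius map\<close>

text \<open>Multiplication by a nonzero \<open>x\<close> permutes the nonzero elements; comparing
  their products gives x^(q - 1) = 1.\<close>

lemma finite_field_power_card:
  fixes x :: "'a::{field,finite}"
  shows "x ^ CARD('a) = x"
proof (cases "x = 0")
  case False
  define A where "A = UNIV - {0::'a}"
  have "bij_betw (\<lambda>y. x * y) A A"
    by (rule bij_betwI[where g = "\<lambda>y. y / x"]) (use False in \<open>auto simp: A_def\<close>)
  then have "\<Prod>A = (\<Prod>y\<in>A. x * y)"
    using prod.reindex_bij_betw[of _ A A "\<lambda>y. y"] by force
  also have "\<dots> = x ^ card A * \<Prod>A"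
    by (simp add: prod.distrib)
  finally have "x ^ card A = 1"
    by (simp add: A_def)
  moreover have "CARD('a) = Suc (card A)"
    by (simp add: A_def card_Diff_singleton)
  ultimately show ?thesis by simp
qed (simp add: power_0_left)

lemma finite_field_power_card_minus_1:
  fixes x :: "'a::{field,finite}"
  assumes "x \<noteq> 0"
  shows "x ^ (CARD('a) - 1) = 1"
proof -
  have "x * x ^ (CARD('a) - 1) = x * 1"
    using finite_field_power_card[of x] by (simp flip: power_Suc)
  then show ?thesis using assms by (subst (asm) mult_cancel_left) simp
qed

text \<open>With \<open>u\<close> an inverse of \<open>k\<close> modulo q - 1, the witness is
  \<open>x ^ u\<close>, since exponents of nonzero elements matter only modulo q - 1.\<close>

lemma finite_field_root_exists:
  fixes x :: "'a::{field,finite}"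
  assumes "x \<noteq> 0" "coprime k (CARD('a) - 1)"
  obtains y where "y \<noteq> 0" "y ^ k = x"
proof -
  let ?r = "CARD('a) - 1"
  obtain u where u: "[k * u = Suc 0] (mod ?r)"
    using cong_solve_coprime_nat[OF assms(2)] by blast
  have mod: "x ^ (a mod ?r) = x ^ a" for a
  proof -
    have "x ^ a = x ^ (?r * (a div ?r) + a mod ?r)"
      by (simp only: mult_div_mod_eq)
    also have "\<dots> = x ^ (a mod ?r)"
      by (simp only: power_add power_mult finite_field_power_card_minus_1[OF assms(1)] power_one mult_1_left)
    finally show ?thesis by simp
  qed
  have "(x ^ u) ^ k = x ^ (k * u)"
    by (simp add: mult.commute flip: power_mult)
  also have "\<dots> = x ^ Suc 0"
    using u mod unfolding cong_def by metis
  finally show ?thesis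
    using that[of "x ^ u"] assms by simp
qed

lemma card_field_ge_2: "2 \<le> CARD('a::{field,finite})"
proof -
  have "card {0::'a, 1} \<le> CARD('a)" by (rule card_mono) auto
  then show ?thesis by simp
qed

text \<open>The polynomial \<open>(X + 1)\<^sup>q - X\<^sup>q - 1\<close> has degree below \<open>q\<close> but vanishes on the whole field.\<close>
lemma of_nat_card_choose_eq_0:
  assumes "0 < i" "i < CARD('a::{field,finite})"
  shows "of_nat (CARD('a) choose i) = (0::'a)"
proof -
  let ?q = "CARD('a)"
  define P where "P = (\<Sum>i\<in>{1..<?q}. monom (of_nat (?q choose i) :: 'a) i)"
  have coeff: "coeff P k = (if k \<in> {1..<?q} then of_nat (?q choose k) else 0)" for k
    by (simp add: P_def coeff_sum sum.delta')
  have root: "poly P x = 0" for x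
  proof -
    have "x + 1 = (x + 1) ^ ?q"
      by (simp add: finite_field_power_card)
    also have "\<dots> = (\<Sum>k\<le>?q. of_nat (?q choose k) * x ^ k)"
      by (simp add: binomial_ring)
    also have "{..?q} = insert 0 (insert ?q {1..<?q})"
      using card_field_ge_2[where 'a='a] by auto
    also have "(\<Sum>k\<in>\<dots>. of_nat (?q choose k) * x ^ k) = 1 + (x + poly P x)"
      using card_field_ge_2[where 'a='a]
      by (subst sum.insert) (auto simp: P_def poly_sum poly_monom finite_field_power_card)
    finally show ?thesis by simp
  qed
  have "degree P < ?q"
    by (rule degree_lessI) (auto simp: coeff)
  moreover have "?q \<le> degree P" if "P \<noteq> 0"
    using card_poly_roots_bound[OF that] root by simp
  ultimately have "P = 0" by fastforce
  then show ?thesis using coeff[of i] assms by simp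
qed

section \<open>Frobenius on an extension field and the orbits of roots\<close>

locale finite_field_embedding =
  fixes \<iota> :: "'a::{field,finite} \<Rightarrow> 'b::field"
  assumes hom_add: "\<iota> (x + y) = \<iota> x + \<iota> y"
    and hom_mult: "\<iota> (x * y) = \<iota> x * \<iota> y"
    and hom_one: "\<iota> 1 = 1"
begin

lemma hom_zero: "\<iota> 0 = 0"
  using hom_add[of 0 0] by (simp only: add_0_left add_cancel_right_right)

lemma hom_nonzero: "x \<noteq> 0 \<Longrightarrow> \<iota> x \<noteq> 0"
  using hom_mult[of x "inverse x"] by (auto simp: hom_one)

lemma hom_diff: "\<iota> (x - y) = \<iota> x - \<iota> y"
  using hom_add[of "x - y" y] by simp

lemma hom_power: "\<iota> (x ^ k) = \<iota> x ^ k"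
  by (induction k) (simp_all add: hom_one hom_mult)

lemma hom_of_nat: "\<iota> (of_nat k) = of_nat k"
  by (induction k) (simp_all add: hom_zero hom_one hom_add)

lemma CHAR_eq: "CHAR('b) = CHAR('a)"
proof (rule CHAR_eqI)
  show "of_nat CHAR('a) = (0::'b)"
    by (metis hom_of_nat hom_zero of_nat_CHAR)
  show "CHAR('a) dvd k" if "of_nat k = (0::'b)" for k
    using that hom_nonzero[of "of_nat k"] by (auto simp: hom_of_nat of_nat_eq_0_iff_char_dvd)
qed

text \<open>The inner binomial coefficients vanish in the small field and hence, through
  \<open>\<iota>\<close>, in the extension, which may be infinite.\<close>

lemma frobenius_add: "(x + y :: 'b) ^ CARD('a) = x ^ CARD('a) + y ^ CARD('a)"
proof -
  have "(x + y) ^ CARD('a) = (\<Sum>k\<le>CARD('a). of_nat (CARD('a) choose k) * x ^ k * y ^ (CARD('a) - k))"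
    by (rule binomial_ring)
  also have "\<dots> = (\<Sum>k\<in>{0, CARD('a)}. of_nat (CARD('a) choose k) * x ^ k * y ^ (CARD('a) - k))"
  proof (rule sum.mono_neutral_right, goal_cases)
    case 3
    have "of_nat (CARD('a) choose k) = (0::'b)" if "0 < k" "k < CARD('a)" for k
      using of_nat_card_choose_eq_0[OF that] by (metis hom_of_nat hom_zero)
    then show ?case by auto
  qed auto
  also have "\<dots> = x ^ CARD('a) + y ^ CARD('a)"
    using card_field_ge_2[where 'a='a] by (simp add: add.commute)
  finally show ?thesis .
qed

lemma frobenius_uminus: "(- x :: 'b) ^ CARD('a) = - (x ^ CARD('a))"
  using frobenius_add[of x "- x"]
  by (simp add: power_0_left eq_neg_iff_add_eq_0 add.commute)

text \<open>By additivity x^q = (x - 1)^q + 1, so (x - 1)^q = 0. Thus the extension has no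
  nontrivial q-th roots of unity.\<close>

lemma frobenius_eq_1: "(x :: 'b) ^ CARD('a) = 1 \<Longrightarrow> x = 1"
  using frobenius_add[of "x - 1" 1] by simp

text \<open>Coefficients from the small field are fixed by the q-th power map, so this map sends the
  polynomial to itself while it moves the point \<open>x\<close>.\<close>

lemma order_frobenius_power:
  assumes "g \<noteq> 0"
  shows "order (x ^ (CARD('a) ^ k)) (map_poly \<iota> g) = order x (map_poly \<iota> g)"
proof (induction k)
  case (Suc k)
  have "map_poly (\<lambda>x. x ^ CARD('a)) (map_poly \<iota> g) = map_poly \<iota> g"
    by (subst map_poly_map_poly)
      (simp_all add: hom_zero power_0_left o_def finite_field_power_card flip: hom_power)
  moreover have "map_poly \<iota> g \<noteq> 0"
    using assms by (metis hom_nonzero hom_zero map_poly_eq_0_iff)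
  ultimately have "order ((x ^ (CARD('a) ^ k)) ^ CARD('a)) (map_poly \<iota> g) = order (x ^ (CARD('a) ^ k)) (map_poly \<iota> g)"
    using order_map_poly_hom[of "\<lambda>x. x ^ CARD('a)" "map_poly \<iota> g" "x ^ (CARD('a) ^ k)"]
    by (simp add: power_0_left frobenius_add power_mult_distrib)
  then show ?case
    using Suc by (simp add: power_mult[symmetric] mult.commute)
qed simp

text \<open>The multiplicity of a root of the generator is constant along Frobenius orbits, so the
  generator is a product of powers of block polynomials. A block need only lie inside the forward
  orbit of some \<open>x\<close>, and may be empty.\<close>

lemma frobenius_orbit_generator:
  assumes code: "constacyclic_code \<mu> N C" and N: "0 < N"
    and U: "finite U" and split: "map_poly \<iota> (monom 1 N - [:\<mu>:]) = root_poly U ^ P"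
    and J: "finite J" "U = (\<Union>j\<in>J. B j)"
    and disjoint: "\<And>i j. i \<in> J \<Longrightarrow> j \<in> J \<Longrightarrow> i \<noteq> j \<Longrightarrow> B i \<inter> B j = {}"
    and orbit: "\<And>j. j \<in> J \<Longrightarrow> \<exists>x. B j \<subseteq> range (\<lambda>k. x ^ (CARD('a) ^ k))"
  shows "\<exists>\<epsilon>. (\<forall>j\<in>J. \<epsilon> j \<le> P) \<and> gen_by \<iota> \<mu> N C (\<Prod>j\<in>J. root_poly (B j) ^ \<epsilon> j)"
proof -
  obtain g where monic: "lead_coeff g = 1" and dvd: "g dvd monom 1 N - [:\<mu>:]"
    and gen: "C = gen_code \<mu> N g"
    using constacyclic_code_generator[OF code N] by blast
  define G where "G = map_poly \<iota> g"
  have g: "g \<noteq> 0" using monic by auto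
  have G_monic: "lead_coeff G = 1"
    using monic hom_nonzero[of "lead_coeff g"]
    by (simp add: G_def lead_coeff_map_poly_nz hom_zero hom_one)
  obtain h where "monom 1 N - [:\<mu>:] = g * h" using dvd by blast
  then have "root_poly U ^ P = G * map_poly \<iota> h"
    by (simp add: G_def split[symmetric] map_poly_hom_mult hom_zero hom_add hom_mult)
  then have G_dvd: "G dvd root_poly U ^ P" by simp
  \<comment> \<open>An empty block contributes the factor 1 whatever its exponent; the value 0 keeps
    the bound by \<open>P\<close>.\<close>
  define \<epsilon> where "\<epsilon> j = (if B j = {} then 0 else order (SOME x. x \<in> B j) G)" for j
  have const: "order r G = \<epsilon> j" if j: "j \<in> J" and r: "r \<in> B j" for r j
  proof -
    obtain x where x: "B j \<subseteq> range (\<lambda>k. x ^ (CARD('a) ^ k))" using orbit[OF j] by blast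
    have "order s G = order x G" if "s \<in> B j" for s
      using x that order_frobenius_power[OF g] by (auto simp: G_def)
    then show ?thesis
      using r someI[of "\<lambda>x. x \<in> B j" r] by (auto simp: \<epsilon>_def)
  qed
  \<comment> \<open>\<open>root_poly U\<close> has simple roots, so its power has multiplicity
    exactly \<open>P\<close> at each of them. This bounds the exponents of any divisor.\<close>
  have order_U: "order r (root_poly U ^ P) = P" if "r \<in> U" for r
  proof -
    have "root_poly U = [:- r, 1:] ^ 1 * root_poly (U - {r})"
      using prod.remove[OF U that] by (simp only: root_poly_def power_one_right)
    moreover have "poly (root_poly (U - {r})) r \<noteq> 0"
      using U by (simp add: root_poly_def poly_prod)
    ultimately have "root_poly U ^ P = [:- r, 1:] ^ P * root_poly (U - {r}) ^ P"
      and "order r (root_poly (U - {r}) ^ P) = 0"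
      by (simp_all only: power_mult_distrib power_one_right order_0I poly_power power_not_zero not_False_eq_True)
    then show ?thesis
      by (simp add: order_mult order_power_n_n)
  qed
  have "\<epsilon> j \<le> P" if j: "j \<in> J" for j
  proof (cases "B j = {}")
    case False
    then obtain r where r: "r \<in> B j" by blast
    then have "r \<in> U" using j J by blast
    then have "order r G \<le> P"
      using dvd_imp_order_le[OF _ G_dvd, of r] by (simp add: order_U)
    then show ?thesis using const[OF j r] by simp
  qed (simp add: \<epsilon>_def)
  moreover have "G = (\<Prod>j\<in>J. root_poly (B j) ^ \<epsilon> j)"
  proof -
    have "G = (\<Prod>r\<in>U. [:- r, 1:] ^ order r G)"
      by (rule monic_dvd_root_poly_power[OF U G_monic G_dvd])
    also have "\<dots> = (\<Prod>j\<in>J. \<Prod>r\<in>B j. [:- r, 1:] ^ order r G)"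
      unfolding J(2) using J U disjoint by (intro prod.UNION_disjoint) auto
    also have "\<dots> = (\<Prod>j\<in>J. \<Prod>r\<in>B j. [:- r, 1:] ^ \<epsilon> j)"
      by (intro prod.cong refl) (simp add: const)
    also have "\<dots> = (\<Prod>j\<in>J. root_poly (B j) ^ \<epsilon> j)"
      by (simp add: root_poly_def prod_power_distrib)
    finally show ?thesis .
  qed
  ultimately show ?thesis
    using gen by (auto simp: gen_by_def G_def)
qed

end

subsection \<open>Cyclotomic cosets\<close>

lemma cyc_coset_less: "0 < L \<Longrightarrow> s \<in> cyc_coset q L t \<Longrightarrow> s < L"
  by (auto simp: cyc_coset_def)

lemma cyc_coset_0: "cyc_coset q L 0 = {0}"
  by (auto simp: cyc_coset_def)

text \<open>Membership can be reversed: as \<open>q\<close> is invertible modulo \<open>L\<close>, a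
  further power of \<open>q\<close> brings \<open>s\<close> back to \<open>t\<close>.\<close>

lemma cyc_coset_eq:
  assumes "coprime q L" "0 < L" "s \<in> cyc_coset q L t"
  shows "cyc_coset q L s = cyc_coset q L t"
proof -
  obtain i where s: "s = t * q ^ i mod L" using assms by (auto simp: cyc_coset_def)
  have step: "s * q ^ j mod L = t * q ^ (i + j) mod L" for j
    by (simp add: s power_add mult.assoc mod_mult_left_eq)
  \<comment> \<open>The exponent represents j - i modulo \<open>ord L q\<close>, shifted by a
    multiple of the order to remain a natural number.\<close>
  have "t * q ^ j mod L = s * q ^ (ord L q * i - i + j) mod L" for j
  proof -
    have pos: "0 < ord L q" using assms(1) by (simp add: coprime_commute)
    have "[(q ^ ord L q) ^ i = 1 ^ i] (mod L)"
      using ord_works[of q L] by (intro cong_pow) blast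
    then have "[t * q ^ (ord L q * i) * q ^ j = t * 1 * q ^ j] (mod L)"
      by (intro cong_mult cong_refl) (simp add: power_mult)
    moreover have exponent: "i + (ord L q * i - i + j) = ord L q * i + j"
      using pos by (cases "ord L q") auto
    ultimately show ?thesis
      unfolding step exponent by (simp add: cong_def power_add mult.assoc)
  qed
  then show ?thesis unfolding cyc_coset_def using step by blast
qed

lemma cyc_coset_disjoint:
  assumes "coprime q L" "0 < L" "cyc_coset q L s \<noteq> cyc_coset q L t"
  shows "cyc_coset q L s \<inter> cyc_coset q L t = {}"
  using cyc_coset_eq[OF assms(1,2)] assms(3) by blast

lemma cyc_coset_split:
  "cyc_coset q L t = cyc_coset (q\<^sup>2) L t \<union> cyc_coset (q\<^sup>2) L (t * q)"
proof -
  have *: "t * q * (q\<^sup>2) ^ i = t * q ^ (2 * i + 1)" "t * (q\<^sup>2) ^ i = t * q ^ (2 * i)" for i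
    by (simp_all add: power_mult power_add)
  show ?thesis
  proof (intro equalityI subsetI)
    fix s assume "s \<in> cyc_coset q L t"
    then obtain i where s: "s = t * q ^ i mod L" by (auto simp: cyc_coset_def)
    show "s \<in> cyc_coset (q\<^sup>2) L t \<union> cyc_coset (q\<^sup>2) L (t * q)"
      by (cases "even i") (auto simp: s cyc_coset_def * elim!: evenE oddE)
  next
    fix s assume "s \<in> cyc_coset (q\<^sup>2) L t \<union> cyc_coset (q\<^sup>2) L (t * q)"
    then obtain i where "s = t * q ^ (2 * i) mod L \<or> s = t * q ^ (2 * i + 1) mod L"
      by (auto simp only: cyc_coset_def *)
    then show "s \<in> cyc_coset q L t"
      unfolding cyc_coset_def by blast
  qed
qed

text \<open>A common element makes an even and an odd power of \<open>q\<close> agree after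
  multiplication by \<open>t\<close>. Removing the \<open>l\<close>-part of \<open>t\<close> leaves
  a congruence modulo \<open>l\<close>, where exponents are determined modulo the even order, so
  their parities would agree.\<close>

lemma cyc_coset_square_disjoint:
  assumes l: "prime l" and q: "coprime q l" and ord: "even (ord l q)" and t: "\<not> l ^ m dvd t"
  shows "cyc_coset (q\<^sup>2) (l ^ m) t \<inter> cyc_coset (q\<^sup>2) (l ^ m) (t * q) = {}"
proof (rule ccontr)
  assume "\<not> ?thesis"
  then obtain i j where "t * (q\<^sup>2) ^ i mod l ^ m = t * q * (q\<^sup>2) ^ j mod l ^ m"
    by (auto simp: cyc_coset_def)
  then have cong: "[t * q ^ (2 * i) = t * q ^ (2 * j + 1)] (mod l ^ m)"
    unfolding cong_def power_mult power_add power_one_right by (simp only: ac_simps)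
  have "t \<noteq> 0" using t by (rule contrapos_nn) simp
  moreover have "\<not> is_unit l" using l by auto
  ultimately obtain v u where tvu: "t = l ^ v * u" and u: "\<not> l dvd u"
    by (rule multiplicity_decompose')
  \<comment> \<open>A positive power of \<open>l\<close> must remain in the modulus after
    \<open>l ^ v\<close> is cancelled.\<close>
  have v: "v < m"
  proof (rule ccontr)
    assume "\<not> v < m"
    then have "l ^ m dvd l ^ v" by (simp add: le_imp_power_dvd)
    then show False using t unfolding tvu by (simp only: dvd_mult2 simp_thms)
  qed
  then have m: "l ^ m = l ^ v * l ^ (m - v)" by (simp flip: power_add)
  have "l ^ v * (u * q ^ (2 * i) mod l ^ (m - v)) = l ^ v * (u * q ^ (2 * j + 1) mod l ^ (m - v))"
    using cong unfolding tvu m cong_def mult_mod_right mult.assoc .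
  moreover have "l ^ v \<noteq> 0" using l by (simp add: prime_gt_0_nat)
  ultimately have "[u * q ^ (2 * i) = u * q ^ (2 * j + 1)] (mod l ^ (m - v))"
    by (simp only: cong_def mult_cancel_left simp_thms)
  moreover have "l dvd l ^ (m - v)" using v by (simp add: dvd_power)
  ultimately have "[u * q ^ (2 * i) = u * q ^ (2 * j + 1)] (mod l)"
    by (rule cong_dvd_modulus_nat)
  moreover have "coprime u l" using prime_imp_coprime[OF l u] by (simp add: coprime_commute)
  ultimately have "[q ^ (2 * i) = q ^ (2 * j + 1)] (mod l)"
    by (simp only: cong_mult_lcancel_nat)
  then have "[2 * i = 2 * j + 1] (mod ord l q)"
    using order_divides_expdiff[of l q] q by (simp only: coprime_commute simp_thms)
  then have "[2 * i = 2 * j + 1] (mod 2)"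
    using ord by (rule cong_dvd_modulus_nat)
  then show False unfolding cong_def by presburger
qed

text \<open>y^l - 1 is y - 1 times a sum of \<open>l\<close> powers, each congruent to 1 modulo
  \<open>l\<close>, so every step gains one factor \<open>l\<close>. Working in the integers makes y
  - 1 a true difference.\<close>

lemma cong_1_power_prime_power:
  fixes x l :: nat
  assumes "[x = 1] (mod l)"
  shows "[x ^ (l ^ k) = 1] (mod l ^ Suc k)"
proof (induction k)
  case 0
  then show ?case using assms by simp
next
  case (Suc k)
  define y where "y = int x ^ (l ^ k)"
  have "[y = 1] (mod int (l ^ Suc k))"
    using Suc by (simp add: y_def flip: cong_int_iff)
  then have "int (l ^ Suc k) dvd y - 1"
    by (simp add: cong_iff_dvd_diff)
  moreover have "[y = 1] (mod int l)"
    using assms cong_pow[of "int x" 1 "int l" "l ^ k"] by (simp add: y_def flip: cong_int_iff)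
  then have "[(\<Sum>i<l. y ^ i) = (\<Sum>i<l. 1 ^ i)] (mod int l)"
    by (intro cong_sum cong_pow)
  then have "int l dvd (\<Sum>i<l. y ^ i)"
    by (simp add: cong_def dvd_eq_mod_eq_0)
  ultimately have "int (l ^ Suc k) * int l dvd (y - 1) * (\<Sum>i<l. y ^ i)"
    by (rule mult_dvd_mono)
  also have "(y - 1) * (\<Sum>i<l. y ^ i) = y ^ l - 1"
    by (simp add: power_diff_1_eq)
  finally have "[y ^ l = 1] (mod int (l ^ Suc (Suc k)))"
    by (simp add: cong_iff_dvd_diff mult.commute)
  then show ?case
    by (simp add: y_def mult.commute flip: power_mult cong_int_iff)
qed

text \<open>The odd order modulo \<open>l\<close> times the odd number \<open>l ^ (m - 1)\<close>
  serves as \<open>K\<close>. In (B1) this is an odd number of Frobenius steps that fixes every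
  power of \<open>\<eta>\<close>.\<close>

lemma odd_exponent_cong_1:
  fixes q l :: nat
  assumes "odd (ord l q)" "odd l" "0 < m"
  obtains K where "odd K" "[q ^ K = 1] (mod l ^ m)"
proof
  show "odd (ord l q * l ^ (m - 1))" using assms by simp
  have "[(q ^ ord l q) ^ (l ^ (m - 1)) = 1] (mod l ^ Suc (m - 1))"
    using ord_works by (intro cong_1_power_prime_power) blast
  then show "[q ^ (ord l q * l ^ (m - 1)) = 1] (mod l ^ m)"
    using assms by (simp add: power_mult)
qed

subsection \<open>Roots of the constacyclic modulus\<close>

lemma UN_times_bool: "(\<Union>j\<in>A \<times> UNIV. f j) = (\<Union>i\<in>A. f (i, True) \<union> f (i, False))"
  by (auto simp: UNIV_bool)

lemma prim_root_mod:
  assumes "prim_root \<eta> L"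
  shows "\<eta> ^ (k mod L) = \<eta> ^ k"
proof -
  have "\<eta> ^ k = \<eta> ^ (L * (k div L) + k mod L)"
    by (simp only: mult_div_mod_eq)
  also have "\<dots> = \<eta> ^ (k mod L)"
    using assms unfolding prim_root_def power_add power_mult by simp
  finally show ?thesis by simp
qed

lemma prim_root_nonzero: "prim_root \<eta> L \<Longrightarrow> 0 < L \<Longrightarrow> \<eta> \<noteq> 0"
  by (auto simp: prim_root_def power_0_left)

lemma prim_root_inj:
  assumes prim: "prim_root \<eta> L"
  shows "inj_on (\<lambda>s. \<eta> ^ s) {..<L}"
proof (rule linorder_inj_onI)
  fix s t assume st: "s < t" "s \<in> {..<L}" "t \<in> {..<L}"
  then have "\<eta> \<noteq> 0" using prim_root_nonzero[OF prim] by auto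
  moreover have "\<eta> ^ t = \<eta> ^ s * \<eta> ^ (t - s)"
    using st by (simp flip: power_add)
  moreover have "\<eta> ^ (t - s) \<noteq> 1"
    using prim st by (simp add: prim_root_def)
  ultimately show "\<eta> ^ s \<noteq> \<eta> ^ t" by simp
qed auto

locale cyclotomic_extension = finite_field_embedding \<iota>
  for \<iota> :: "'a::{field,finite} \<Rightarrow> 'b::field" +
  fixes \<eta> :: 'b and L :: nat
  assumes prim: "prim_root \<eta> L" and L_odd: "odd L" and char_odd: "odd CHAR('a)"
begin

lemma L_pos: "0 < L"
  using L_odd by (rule odd_pos)

lemma one_neq_minus_one: "(1::'b) \<noteq> - 1"
proof
  assume "(1::'b) = - 1"
  then have "of_nat 2 = (0::'b)"
    by (simp add: eq_neg_iff_add_eq_0)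
  then have "CHAR('a) dvd 2"
    by (simp only: of_nat_eq_0_iff_char_dvd CHAR_eq)
  then have "CHAR('a) = 1"
    using char_odd by (metis dvd_refl prime_nat_iff two_is_prime_nat)
  then show False by simp
qed

text \<open>The zeros of the product of the X - \<open>\<eta> ^ s\<close> after X is replaced by cX.
  A second substitution multiplies the parameters, and the sign of \<open>c\<close> separates the
  two halves of the roots.\<close>

definition roots :: "nat set \<Rightarrow> 'b \<Rightarrow> 'b set" where
  "roots S c = (\<lambda>s. \<eta> ^ s / c) ` S"

lemma inj_on_roots: "c \<noteq> 0 \<Longrightarrow> inj_on (\<lambda>s. \<eta> ^ s / c) {..<L}"
  using prim_root_inj[OF prim] by (auto simp: inj_on_def)

lemma finite_roots: "S \<subseteq> {..<L} \<Longrightarrow> finite (roots S c)"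
  unfolding roots_def by (meson finite_imageI finite_lessThan finite_subset)

lemma roots_disjoint:
  assumes "c \<noteq> 0" "S \<subseteq> {..<L}" "T \<subseteq> {..<L}" "S \<inter> T = {}"
  shows "roots S c \<inter> roots T c = {}"
  using inj_on_image_Int[OF inj_on_roots[OF assms(1)] assms(2,3)] assms(4) by (simp add: roots_def)

text \<open>Equality would make one power of \<open>\<eta>\<close> the negative of another; raised
  to the odd power \<open>L\<close> this reads 1 = -1.\<close>

lemma roots_uminus_disjoint:
  assumes "c \<noteq> 0"
  shows "roots S c \<inter> roots T (- c) = {}"
proof -
  have "\<eta> ^ s / c \<noteq> \<eta> ^ t / (- c)" for s t
  proof
    assume "\<eta> ^ s / c = \<eta> ^ t / (- c)"
    then have "\<eta> ^ s = - (\<eta> ^ t)" using assms by (simp add: field_simps)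
    then have "(\<eta> ^ L) ^ s = - ((\<eta> ^ L) ^ t)"
      using L_odd by (metis mult.commute power_minus_odd power_mult)
    then show False using prim one_neq_minus_one by (simp add: prim_root_def)
  qed
  then show ?thesis by (auto simp: roots_def)
qed

lemma monic_assoc_scale_cyclotomic:
  assumes "S \<subseteq> {..<L}" "c \<noteq> 0"
  shows "monic_assoc (scale_var (\<Prod>s\<in>S. [:- (\<eta> ^ s), 1:]) c) = root_poly (roots S c)"
proof -
  have "inj_on (\<lambda>s. \<eta> ^ s) S"
    using prim_root_inj[OF prim] assms(1) by (rule inj_on_subset)
  then have "(\<Prod>s\<in>S. [:- (\<eta> ^ s), 1:]) = root_poly ((\<lambda>s. \<eta> ^ s) ` S)"
    by (simp add: root_poly_def prod.reindex)
  moreover have "finite S" using assms(1) finite_subset by blast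
  ultimately show ?thesis
    using assms(2) by (simp add: monic_assoc_scale_root_poly roots_def image_image)
qed

lemma monic_assoc_scale_roots:
  assumes "S \<subseteq> {..<L}" "d \<noteq> 0"
  shows "monic_assoc (scale_var (root_poly (roots S c)) d) = root_poly (roots S (c * d))"
  using monic_assoc_scale_root_poly[OF finite_roots[OF assms(1)] assms(2)]
  by (simp add: roots_def image_image)

text \<open>With w = c^(-2L), the hypothesis \<open>c_pow\<close> says that w^P is the image of
  \<open>\<mu>\<close>, so the modulus is the P-th power of X^(2L) - w. The latter is monic of
  degree 2L and vanishes at the 2L distinct points \<open>\<eta> ^ s / c\<close> and their
  negatives.\<close>

lemma constacyclic_modulus_split:
  assumes c: "c \<noteq> 0" and P: "P = CHAR('a) ^ n" and N: "N = 2 * L * P"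
    and c_pow: "c ^ N * \<iota> \<mu> = 1"
  shows "map_poly \<iota> (monom 1 N - [:\<mu>:]) = root_poly (roots {..<L} c \<union> roots {..<L} (- c)) ^ P"
proof -
  define U where "U = roots {..<L} c \<union> roots {..<L} (- c)"
  define w where "w = inverse (c ^ (2 * L))"
  define W where "W = monom 1 (2 * L) - [:w:]"
  have U: "finite U" by (simp add: U_def finite_roots)
  have card_roots: "card (roots {..<L} d) = L" if "d \<noteq> 0" for d
    using card_image[OF inj_on_roots[OF that]] by (simp add: roots_def)
  have "card U = 2 * L"
    using card_Un_disjoint[of "roots {..<L} c" "roots {..<L} (- c)"] c
    by (simp add: U_def finite_roots roots_uminus_disjoint card_roots)
  then have deg_U: "degree (root_poly U) = 2 * L"
    using U by (simp add: degree_root_poly)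
  have deg_W: "degree W = 2 * L"
    unfolding W_def using L_pos by (intro degree_monom_minus_const) simp
  have lead_W: "lead_coeff W = 1"
    using L_pos unfolding deg_W by (simp add: W_def coeff_pCons split: nat.split)
  have "poly W r = 0" if r: "r \<in> U" for r
  proof -
    obtain s where "r = \<eta> ^ s / c \<or> r = \<eta> ^ s / (- c)"
      using r unfolding U_def roots_def by blast
    moreover have "(\<eta> ^ s) ^ (2 * L) = 1"
      using prim by (metis mult.commute power_mult power_one prim_root_def)
    ultimately have "r ^ (2 * L) = w"
      by (auto simp: w_def power_divide inverse_eq_divide)
    then show ?thesis by (simp add: W_def poly_monom)
  qed
  then have "root_poly U dvd W" by (rule root_poly_dvd[OF U])
  then obtain t where t: "W = root_poly U * t" by blast
  have "W \<noteq> 0" using lead_W by auto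
  then have "t \<noteq> 0" using t by auto
  then have "degree t = 0"
    using t deg_U deg_W by (simp add: degree_mult_eq)
  moreover have "lead_coeff t = 1"
    using lead_W t by (simp add: lead_coeff_mult)
  ultimately have "t = 1"
    by (metis degree_eq_zeroE lead_coeff_pCons(2) one_pCons degree_pCons_0 coeff_pCons_0)
  then have W: "W = root_poly U" using t by simp
  \<comment> \<open>Oddness makes the P-th power of -w equal to -(w^P), the sign needed for the
    constant term.\<close>
  have P_odd: "odd P" using char_odd P by simp
  have prime: "prime CHAR('b poly)"
    using CHAR_eq finite_imp_CHAR_pos[where 'a='a] prime_CHAR_semidom[where 'a='a] by simp
  have "W ^ P = (monom 1 (2 * L) + [:- w:]) ^ CHAR('b poly) ^ n"
    unfolding W_def P semiring_char_poly CHAR_eq diff_conv_add_uminus by simp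
  also have "\<dots> = monom 1 (2 * L) ^ P + [:- w:] ^ P"
    using prime by (subst freshmans_dream') (simp_all add: P CHAR_eq)
  also have "\<dots> = monom 1 N - [:w ^ P:]"
    using P_odd by (simp add: monom_power N poly_const_pow mult.commute)
  also have "w ^ P = \<iota> \<mu>"
  proof -
    have "w ^ P * c ^ N = 1"
      using c by (simp add: w_def N power_mult power_inverse)
    then show ?thesis
      using c_pow c by (metis mult.commute mult_cancel_left power_not_zero)
  qed
  also have "monom 1 N - [:\<iota> \<mu>:] = map_poly \<iota> (monom 1 N - [:\<mu>:])"
    by (rule poly_eqI) (simp add: coeff_map_poly hom_zero hom_one  hom_diff coeff_pCons split: nat.split)
  finally show ?thesis by (simp add: W U_def)
qed

text \<open>One statement serves all three cases, \<open>S j\<close> being the exponents for +c and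
  \<open>T j\<close> those for -c in one block. In (A) one of the two is empty, in (B1) they
  coincide, and in (B2) they are the two halves of a q-coset, apart from the coset of 0.\<close>

lemma signed_orbit_generator:
  assumes code: "constacyclic_code \<mu> N C"
    and c: "c \<noteq> 0" and P: "P = CHAR('a) ^ n" and N: "N = 2 * L * P" and c_pow: "c ^ N * \<iota> \<mu> = 1"
    and J: "finite J" "(\<Union>j\<in>J. S j) = {..<L}" "(\<Union>j\<in>J. T j) = {..<L}"
    and disjoint: "\<And>i j. i \<in> J \<Longrightarrow> j \<in> J \<Longrightarrow> i \<noteq> j \<Longrightarrow> S i \<inter> S j = {} \<and> T i \<inter> T j = {}"
    and orbit: "\<And>j. j \<in> J \<Longrightarrow> \<exists>x. roots (S j) c \<union> roots (T j) (- c) \<subseteq> range (\<lambda>k. x ^ (CARD('a) ^ k))"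
  shows "\<exists>\<epsilon>. (\<forall>j\<in>J. \<epsilon> j \<le> P) \<and>
    gen_by \<iota> \<mu> N C (\<Prod>j\<in>J. (root_poly (roots (S j) c) * root_poly (roots (T j) (- c))) ^ \<epsilon> j)"
proof -
  have sub: "S j \<subseteq> {..<L}" "T j \<subseteq> {..<L}" if "j \<in> J" for j
    using that J by auto
  have "0 < CHAR('a)" using char_odd by (rule odd_pos)
  then have N_pos: "0 < N" using L_pos N P by simp
  define B where "B j = roots (S j) c \<union> roots (T j) (- c)" for j
  have cover: "roots {..<L} c \<union> roots {..<L} (- c) = (\<Union>j\<in>J. B j)"
  proof -
    have "(\<Union>j\<in>J. roots (S j) c) = roots {..<L} c" "(\<Union>j\<in>J. roots (T j) (- c)) = roots {..<L} (- c)"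
      unfolding roots_def by (simp_all only: image_UN[symmetric] J)
    then show ?thesis unfolding B_def by blast
  qed
  have disj: "B i \<inter> B j = {}" if "i \<in> J" "j \<in> J" "i \<noteq> j" for i j
    using roots_disjoint[OF c sub(1)[OF that(1)] sub(1)[OF that(2)]]
      roots_disjoint[OF _ sub(2)[OF that(1)] sub(2)[OF that(2)], of "- c"]
      roots_uminus_disjoint[OF c, of "S i" "T j"] roots_uminus_disjoint[OF c, of "S j" "T i"]
      disjoint[OF that] c
    unfolding B_def by auto
  have "\<exists>\<epsilon>. (\<forall>j\<in>J. \<epsilon> j \<le> P) \<and> gen_by \<iota> \<mu> N C (\<Prod>j\<in>J. root_poly (B j) ^ \<epsilon> j)"
    by (rule frobenius_orbit_generator[OF code N_pos _ constacyclic_modulus_split[OF c P N c_pow] J(1) cover])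
      (simp_all add: finite_roots disj, simp add: B_def orbit[simplified])
  moreover have "root_poly (B j) = root_poly (roots (S j) c) * root_poly (roots (T j) (- c))"
    if "j \<in> J" for j
    unfolding B_def using c sub[OF that] by (intro root_poly_union finite_roots roots_uminus_disjoint)
  ultimately show ?thesis by (simp cong: prod.cong)
qed

lemma root_frobenius_power:
  assumes "c ^ CARD('a) = c"
  shows "(\<eta> ^ t / c) ^ (CARD('a) ^ k) = \<eta> ^ (t * CARD('a) ^ k mod L) / c"
proof -
  have "c ^ (CARD('a) ^ k) = c"
    by (induction k) (simp_all add: power_mult assms)
  then show ?thesis
    by (simp add: prim_root_mod[OF prim] power_divide power_mult)
qed

text \<open>Each Frobenius step negates \<open>c\<close>, so the parity of \<open>k\<close> ties the
  sign to the power of q in the exponent of \<open>\<eta>\<close>.\<close>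

lemma root_frobenius_power_sign:
  assumes "c ^ CARD('a) = - c"
  shows "(\<eta> ^ t / c) ^ (CARD('a) ^ k) = \<eta> ^ (t * CARD('a) ^ k mod L) / (if even k then c else - c)"
proof -
  have "c ^ (CARD('a) ^ k) = (if even k then c else - c)"
    by (induction k) (simp_all add: power_mult power_mult[of _ _ "CARD('a)"] assms frobenius_uminus mult.commute[of "CARD('a)"])
  then show ?thesis
    by (simp add: prim_root_mod[OF prim] power_divide power_mult)
qed

lemma monic_assoc_scale_Mpoly:
  "c \<noteq> 0 \<Longrightarrow> monic_assoc (scale_var (Mpoly r L \<eta> t) c) = root_poly (roots (cyc_coset r L t) c)"
  unfolding Mpoly_def using L_pos by (intro monic_assoc_scale_cyclotomic) (auto dest: cyc_coset_less)

lemma monic_assoc_scale_Npoly: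
  "c \<noteq> 0 \<Longrightarrow> monic_assoc (scale_var (Npoly r L \<eta> t) c) = root_poly (roots (cyc_coset (r\<^sup>2) L t) c)"
  unfolding Npoly_def using L_pos by (intro monic_assoc_scale_cyclotomic) (auto dest: cyc_coset_less)

lemma monic_assoc_scale_roots_coset:
  "d \<noteq> 0 \<Longrightarrow> monic_assoc (scale_var (root_poly (roots (cyc_coset r L t) c)) d) =
     root_poly (roots (cyc_coset r L t) (c * d))"
  using L_pos by (intro monic_assoc_scale_roots) (auto dest: cyc_coset_less)

end

theorem theorem3p2:
  fixes \<xi> lam :: "'a::{field,finite}"
    and \<iota> :: "'a \<Rightarrow> 'b::field"
    and \<eta> \<alpha>1 \<beta>1 :: 'b
    and p l m n e :: nat
    and \<rho> :: "nat \<Rightarrow> nat"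
    and C :: "'a list set"
  defines "q \<equiv> CARD('a)"
    and "L \<equiv> l ^ m"
    and "N \<equiv> 2 * l ^ m * p ^ n"
  assumes p_prime: "prime p" and p_odd: "odd p" and char: "CHAR('a) = p"
    and \<xi>_gen: "\<forall>x::'a. x \<noteq> 0 \<longrightarrow> (\<exists>k::nat. x = \<xi> ^ k)"
    and l_prime: "prime l" and l_odd: "odd l" and l_neq: "l \<noteq> p"
    and l_coprime: "gcd l (q - 1) = 1"
    and m_pos: "0 < m" and n_pos: "0 < n"
    and \<iota>_add: "\<forall>x y. \<iota> (x + y) = \<iota> x + \<iota> y"
    and \<iota>_mult: "\<forall>x y. \<iota> (x * y) = \<iota> x * \<iota> y"
    and \<iota>_one: "\<iota> 1 = 1" and \<iota>_inj: "inj \<iota>"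
    and \<eta>_prim: "prim_root \<eta> L"
    and \<rho>0: "\<rho> 0 = 0"
    and \<rho>_range: "\<forall>i\<le>e. \<rho> i < L"
    and \<rho>_distinct: "inj_on (\<lambda>i. cyc_coset q L (\<rho> i)) {0..e}"
    and \<rho>_cover: "(\<Union>i\<in>{0..e}. cyc_coset q L (\<rho> i)) = {0..<L}"
    and \<alpha>1_sq: "\<alpha>1 ^ 2 = \<iota> \<xi>"
    and \<beta>1_prim: "prim_root \<beta>1 (2 * (q - 1))"
    and \<beta>1_\<alpha>1: "\<beta>1 ^ L * \<alpha>1 = 1"
    and lam_nz: "lam \<noteq> 0"
    and C_code: "constacyclic_code lam N C"
  shows
    "(lam \<in> range (\<lambda>k::nat. \<xi> ^ (2 * k)) \<longrightarrow>
       (\<exists>a::'a. a \<noteq> 0 \<and> a ^ N * lam = 1 \<and>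
         (\<exists>\<epsilon> \<epsilon>' :: nat \<Rightarrow> nat. (\<forall>i\<le>e. \<epsilon> i \<le> p ^ n \<and> \<epsilon>' i \<le> p ^ n) \<and>
           gen_by \<iota> lam N C
             (\<Prod>i\<in>{0..e}.
                monic_assoc (scale_var (Mpoly q L \<eta> (\<rho> i)) (\<iota> a)) ^ \<epsilon> i *
                monic_assoc (scale_var (Mpoly q L \<eta> (\<rho> i)) (- \<iota> a)) ^ \<epsilon>' i))))
   \<and> (lam \<notin> range (\<lambda>k::nat. \<xi> ^ (2 * k)) \<longrightarrow>
       (\<exists>b::'a. b \<noteq> 0 \<and> b ^ N * lam = \<xi> ^ (p ^ n) \<and>
         (odd (ord l q) \<longrightarrow>
           (\<exists>\<epsilon> :: nat \<Rightarrow> nat. (\<forall>i\<le>e. \<epsilon> i \<le> p ^ n) \<and>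
             gen_by \<iota> lam N C
               (\<Prod>i\<in>{0..e}.
                  monic_assoc (scale_var
                    (monic_assoc (scale_var (Mpoly q L \<eta> (\<rho> i)) \<beta>1) *
                     monic_assoc (scale_var (Mpoly q L \<eta> (\<rho> i)) (- \<beta>1)))
                    (\<iota> b)) ^ \<epsilon> i))) \<and>
         (even (ord l q) \<longrightarrow>
           (\<exists>\<epsilon>0::nat. \<exists>\<epsilon> \<epsilon>' :: nat \<Rightarrow> nat. \<epsilon>0 \<le> p ^ n \<and>
             (\<forall>i\<in>{1..e}. \<epsilon> i \<le> p ^ n \<and> \<epsilon>' i \<le> p ^ n) \<and>
             gen_by \<iota> lam N C
               (monic_assoc (scale_var ([:- inverse \<beta>1, 1:] * [:inverse \<beta>1, 1:]) (\<iota> b)) ^ \<epsilon>0 *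
                (\<Prod>i\<in>{1..e}.
                  monic_assoc (scale_var
                    (monic_assoc (scale_var (Npoly q L \<eta> (\<rho> i)) \<beta>1) *
                     monic_assoc (scale_var (Npoly q L \<eta> (\<rho> i * q)) (- \<beta>1)))
                    (\<iota> b)) ^ \<epsilon> i *
                  monic_assoc (scale_var
                    (monic_assoc (scale_var (Npoly q L \<eta> (\<rho> i * q)) \<beta>1) *
                     monic_assoc (scale_var (Npoly q L \<eta> (\<rho> i)) (- \<beta>1)))
                    (\<iota> b)) ^ \<epsilon>' i))))))"
proof -
  interpret finite_field_embedding \<iota>
    by unfold_locales (simp_all add: \<iota>_add \<iota>_mult \<iota>_one)
  have L_odd': "odd L" and P_odd: "odd (p ^ n)"
    using l_odd p_odd by (simp_all add: L_def)
  \<comment> \<open>Otherwise \<open>\<eta>\<close> to the power \<open>l^(m - 1) q\<close> is 1, and injectivity of Frobenius contradicts primitivity.\<close>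
  have l_not_dvd: "\<not> l dvd q"
  proof
    assume "l dvd q"
    then obtain r where r: "q = l * r" by blast
    have "l ^ (m - 1) * q = L * r"
      using m_pos by (cases m) (simp_all add: L_def r)
    moreover have "\<eta> ^ L = 1"
      using \<eta>_prim by (simp add: prim_root_def)
    ultimately have "(\<eta> ^ (l ^ (m - 1))) ^ q = 1"
      by (simp only: power_mult[symmetric]) (simp only: power_mult power_one)
    then have "\<eta> ^ (l ^ (m - 1)) = 1"
      unfolding q_def by (rule frobenius_eq_1)
    moreover have "0 < l ^ (m - 1)" "l ^ (m - 1) < L"
      using m_pos prime_gt_1_nat[OF l_prime] by (simp_all add: L_def)
    ultimately show False
      using \<eta>_prim by (simp add: prim_root_def)
  qed
  then have coprime_l: "coprime q l"
    using prime_imp_coprime[OF l_prime, of q] by (simp add: coprime_commute)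
  then have coprime_L: "coprime q L" "coprime (q\<^sup>2) L"
    by (simp_all add: L_def)
  interpret cyclotomic_extension \<iota> \<eta> L
    by unfold_locales (use \<eta>_prim L_odd' p_odd in \<open>simp_all add: char\<close>)
  have N: "N = 2 * L * p ^ n" "p ^ n = CHAR('a) ^ n"
    by (simp_all add: N_def L_def char)
  have N2: "N = L * p ^ n * 2"
    by (simp add: N)
  have cover: "(\<Union>i\<in>{0..e}. cyc_coset q L (\<rho> i)) = {..<L}"
    using \<rho>_cover by (simp add: atLeast0LessThan)
  have disjoint: "cyc_coset q L (\<rho> i) \<inter> cyc_coset q L (\<rho> j) = {}" if "i \<le> e" "j \<le> e" "i \<noteq> j" for i j
    using that \<rho>_distinct by (intro cyc_coset_disjoint coprime_L L_pos) (auto dest: inj_onD)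
  have \<alpha>1: "\<alpha>1 \<noteq> 0" and \<beta>1: "\<beta>1 \<noteq> 0"
    using \<beta>1_\<alpha>1 L_pos by (auto simp: power_0_left)
  then have \<xi>: "\<xi> \<noteq> 0"
    using \<alpha>1_sq hom_zero by auto
  \<comment> \<open>The exponent omits the factor 2 of \<open>N\<close>, as q - 1 is even. Taking
    this power permutes the nonzero elements of the small field, so roots exist, and
    \<open>N\<close>-th powers arise by squaring.\<close>
  have coprime_exponent: "coprime (L * p ^ n) (CARD('a) - 1)"
  proof -
    have "\<not> p dvd q - 1"
    proof
      assume "p dvd q - 1"
      moreover have "p dvd q"
        using CHAR_dvd_CARD[where 'a='a] by (simp add: char q_def)
      ultimately have "p dvd q - (q - 1)" by (simp only: dvd_diff_nat)
      then show False
        using p_prime card_field_ge_2[where 'a='a] by (simp add: q_def)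
    qed
    then have "coprime p (q - 1)"
      by (rule prime_imp_coprime[OF p_prime])
    moreover have "coprime l (q - 1)"
      using l_coprime by (simp only: coprime_iff_gcd_eq_1)
    ultimately show ?thesis by (simp add: L_def q_def)
  qed

  show ?thesis
  proof (intro conjI impI)

    \<comment> \<open>Case (A): Frobenius fixes c\<close>
    assume "lam \<in> range (\<lambda>k::nat. \<xi> ^ (2 * k))"
    then obtain k where k: "lam = \<xi> ^ (2 * k)" by blast
    \<comment> \<open>Squaring the defining equation gives a^N = 1/lam, because \<open>lam\<close>
      is the square of \<open>\<xi> ^ k\<close>.\<close>
    obtain a where a: "a \<noteq> 0" "a ^ (L * p ^ n) = inverse (\<xi> ^ k)"
      using finite_field_root_exists[OF _ coprime_exponent, of "inverse (\<xi> ^ k)"] \<xi> by auto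
    have a_pow: "a ^ N * lam = 1"
    proof -
      have "a ^ N = (inverse (\<xi> ^ k))\<^sup>2"
        unfolding N2 power_mult[of a "L * p ^ n" 2] a(2) ..
      then show ?thesis
        using \<xi> by (simp add: k power_inverse power_mult mult.commute[of 2])
    qed
    define c where "c = \<iota> a"
    have c: "c \<noteq> 0" using a by (simp add: c_def hom_nonzero)
    have c_pow: "c ^ N * \<iota> lam = 1"
      by (simp only: c_def hom_power[symmetric] hom_mult[symmetric] a_pow hom_one)
    have frob: "c ^ CARD('a) = c"
      by (simp only: c_def hom_power[symmetric] finite_field_power_card)
    then have frob': "(- c) ^ CARD('a) = - c"
      by (simp add: frobenius_uminus)
    \<comment> \<open>The Boolean selects the sign: a block with \<open>True\<close> has roots for
      +c only, one with \<open>False\<close> for -c only.\<close>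
    define S where "S = (\<lambda>(i, s). if s then cyc_coset q L (\<rho> i) else {})"
    define T where "T = (\<lambda>(i, s). if s then {} else cyc_coset q L (\<rho> i))"
    have orbit: "roots (cyc_coset q L t) d \<subseteq> range (\<lambda>k. (\<eta> ^ t / d) ^ (CARD('a) ^ k))"
      if "d ^ CARD('a) = d" for t d
      unfolding root_frobenius_power[OF that] by (auto simp: roots_def cyc_coset_def q_def)
    have "\<exists>\<epsilon>. (\<forall>j\<in>{0..e} \<times> UNIV. \<epsilon> j \<le> p ^ n) \<and> gen_by \<iota> lam N C
      (\<Prod>j\<in>{0..e} \<times> UNIV. (root_poly (roots (S j) c) * root_poly (roots (T j) (- c))) ^ \<epsilon> j)"
    proof (rule signed_orbit_generator[OF C_code c N(2,1) c_pow])
      show "(\<Union>j\<in>{0..e} \<times> UNIV. S j) = {..<L}" "(\<Union>j\<in>{0..e} \<times> UNIV. T j) = {..<L}"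
        unfolding cover[symmetric] UN_times_bool by (simp_all add: S_def T_def)
      show "S i \<inter> S j = {} \<and> T i \<inter> T j = {}"
        if "i \<in> {0..e} \<times> UNIV" "j \<in> {0..e} \<times> UNIV" "i \<noteq> j" for i j
        using that disjoint[of "fst i" "fst j"] by (cases i; cases j) (auto simp: S_def T_def)
      show "\<exists>x. roots (S j) c \<union> roots (T j) (- c) \<subseteq> range (\<lambda>k. x ^ (CARD('a) ^ k))"
        if "j \<in> {0..e} \<times> UNIV" for j
      proof (cases j)
        case (Pair i s)
        then show ?thesis
          using orbit[OF frob, of "\<rho> i"] orbit[OF frob', of "\<rho> i"]
          by (cases s) (force simp: S_def T_def roots_def)+
      qed
    qed simp
    then obtain \<epsilon> where \<epsilon>: "\<forall>j\<in>{0..e} \<times> UNIV. \<epsilon> j \<le> p ^ n" and gen: "gen_by \<iota> lam N C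
      (\<Prod>j\<in>{0..e} \<times> UNIV. (root_poly (roots (S j) c) * root_poly (roots (T j) (- c))) ^ \<epsilon> j)"
      by blast
    have "(\<Prod>j\<in>{0..e} \<times> UNIV. (root_poly (roots (S j) c) * root_poly (roots (T j) (- c))) ^ \<epsilon> j) =
      (\<Prod>i\<in>{0..e}. \<Prod>s\<in>UNIV. (root_poly (roots (S (i, s)) c) * root_poly (roots (T (i, s)) (- c))) ^ \<epsilon> (i, s))"
      by (simp add: prod.cartesian_product)
    also have "\<dots> = (\<Prod>i\<in>{0..e}.
        monic_assoc (scale_var (Mpoly q L \<eta> (\<rho> i)) (\<iota> a)) ^ \<epsilon> (i, True) *
        monic_assoc (scale_var (Mpoly q L \<eta> (\<rho> i)) (- \<iota> a)) ^ \<epsilon> (i, False))"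
      using c by (intro prod.cong refl)
        (simp add: UNIV_bool S_def T_def monic_assoc_scale_Mpoly c_def roots_def root_poly_def mult.commute)
    finally show "\<exists>a::'a. a \<noteq> 0 \<and> a ^ N * lam = 1 \<and>
         (\<exists>\<epsilon> \<epsilon>' :: nat \<Rightarrow> nat. (\<forall>i\<le>e. \<epsilon> i \<le> p ^ n \<and> \<epsilon>' i \<le> p ^ n) \<and>
           gen_by \<iota> lam N C
             (\<Prod>i\<in>{0..e}.
                monic_assoc (scale_var (Mpoly q L \<eta> (\<rho> i)) (\<iota> a)) ^ \<epsilon> i *
                monic_assoc (scale_var (Mpoly q L \<eta> (\<rho> i)) (- \<iota> a)) ^ \<epsilon>' i))"
      using a(1) a_pow \<epsilon> gen
      by - (rule exI[of _ a], intro conjI, assumption, assumption,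
        rule exI[of _ "\<lambda>i. \<epsilon> (i, True)"], rule exI[of _ "\<lambda>i. \<epsilon> (i, False)"], simp)
  next

    \<comment> \<open>Case (B): Frobenius negates c\<close>
    assume not_square: "lam \<notin> range (\<lambda>k::nat. \<xi> ^ (2 * k))"
    obtain k where k: "lam = \<xi> ^ k" using \<xi>_gen lam_nz by blast
    then have "odd k" using not_square by (auto elim!: evenE)
    then obtain h where h: "k = 2 * h + 1" by (elim oddE)
    obtain g where g: "p ^ n = 2 * g + 1" using P_odd by (elim oddE)
    \<comment> \<open>Here 2(g - h) = p^n - k, so squaring yields b^N = \<xi>^(p^n)/lam.\<close>
    obtain b where b: "b \<noteq> 0" "b ^ (L * p ^ n) = \<xi> ^ g / \<xi> ^ h"
      using finite_field_root_exists[OF _ coprime_exponent, of "\<xi> ^ g / \<xi> ^ h"] \<xi> by auto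
    have b_pow: "b ^ N * lam = \<xi> ^ (p ^ n)"
    proof -
      have "b ^ N = (\<xi> ^ g / \<xi> ^ h)\<^sup>2"
        unfolding N2 power_mult[of b "L * p ^ n" 2] b(2) ..
      then show ?thesis
        unfolding k h g using \<xi> by (simp add: power_divide power_add power_mult mult.commute[of 2])
    qed
    define c where "c = \<beta>1 * \<iota> b"
    have \<iota>b: "\<iota> b \<noteq> 0" using b by (simp add: hom_nonzero)
    then have c: "c \<noteq> 0" using \<beta>1 by (simp add: c_def)
    \<comment> \<open>The choice of \<open>b\<close> leaves the factor
      \<open>\<xi> ^ (p ^ n)\<close>. As \<xi> is the square of \<open>\<alpha>1\<close>, the whole
      expression is a power of \<open>\<beta>1 ^ L * \<alpha>1\<close>, which is 1.\<close>
    have c_pow: "c ^ N * \<iota> lam = 1"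
    proof -
      have "c ^ N * \<iota> lam = \<beta>1 ^ N * \<iota> (b ^ N * lam)"
        by (simp add: c_def power_mult_distrib hom_mult hom_power)
      also have "\<dots> = (\<beta>1 ^ (L * 2) * \<alpha>1\<^sup>2) ^ (p ^ n)"
        unfolding b_pow \<alpha>1_sq
        by (simp add: N(1) hom_power power_mult_distrib power_mult[symmetric] mult_ac)
      also have "\<beta>1 ^ (L * 2) * \<alpha>1\<^sup>2 = 1"
        by (simp only: power_mult power_mult_distrib[symmetric] \<beta>1_\<alpha>1 power_one)
      finally show ?thesis by simp
    qed
    \<comment> \<open>By the exact order of \<open>\<beta>1\<close> this power squares to 1 but is
      not 1.\<close>
    have "\<beta>1 ^ (q - 1) = - 1"
    proof -
      have "q - 1 > 0" using card_field_ge_2[where 'a='a] by (simp add: q_def)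
      then have "\<beta>1 ^ (q - 1) \<noteq> 1" and "\<beta>1 ^ ((q - 1) * 2) = 1"
        using \<beta>1_prim by (simp_all add: prim_root_def mult.commute)
      then show ?thesis
        by (simp add: power_mult power2_eq_1_iff)
    qed
    moreover have "q = Suc (q - 1)" using card_field_ge_2[where 'a='a] by (simp add: q_def)
    ultimately have "\<beta>1 ^ q = - \<beta>1"
      by (metis mult_minus1_right power_Suc)
    then have frob: "c ^ CARD('a) = - c"
      by (simp add: c_def power_mult_distrib q_def finite_field_power_card flip: hom_power)
    then have frob': "(- c) ^ CARD('a) = - (- c)"
      by (simp add: frobenius_uminus)

    \<comment> \<open>Odd order: both signs lie in one orbit\<close>
    have B1: "\<exists>\<epsilon> :: nat \<Rightarrow> nat. (\<forall>i\<le>e. \<epsilon> i \<le> p ^ n) \<and>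
             gen_by \<iota> lam N C
               (\<Prod>i\<in>{0..e}.
                  monic_assoc (scale_var
                    (monic_assoc (scale_var (Mpoly q L \<eta> (\<rho> i)) \<beta>1) *
                     monic_assoc (scale_var (Mpoly q L \<eta> (\<rho> i)) (- \<beta>1)))
                    (\<iota> b)) ^ \<epsilon> i)" if ord: "odd (ord l q)"
    proof -
      obtain K where K: "odd K" "[q ^ K = 1] (mod L)"
        using odd_exponent_cong_1[OF ord l_odd m_pos] unfolding L_def by blast
      have "\<exists>\<epsilon>. (\<forall>j\<in>{0..e}. \<epsilon> j \<le> p ^ n) \<and> gen_by \<iota> lam N C
        (\<Prod>j\<in>{0..e}. (root_poly (roots (cyc_coset q L (\<rho> j)) c) *
           root_poly (roots (cyc_coset q L (\<rho> j)) (- c))) ^ \<epsilon> j)"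
      proof (rule signed_orbit_generator[OF C_code c N(2,1) c_pow _ cover cover])
        show "\<exists>x. roots (cyc_coset q L (\<rho> j)) c \<union> roots (cyc_coset q L (\<rho> j)) (- c) \<subseteq>
            range (\<lambda>k. x ^ (CARD('a) ^ k))" for j
        proof (intro exI subsetI)
          fix r assume "r \<in> roots (cyc_coset q L (\<rho> j)) c \<union> roots (cyc_coset q L (\<rho> j)) (- c)"
          then obtain i s where r: "r = \<eta> ^ (\<rho> j * q ^ i mod L) / (if s then c else - c)"
            unfolding roots_def cyc_coset_def by (smt (verit) UnE imageE mem_Collect_eq)
          have "[\<rho> j * q ^ (i + K) = \<rho> j * q ^ i * 1] (mod L)"
            unfolding power_add mult.assoc[symmetric] using K(2) by (intro cong_mult cong_refl)
          then have "\<rho> j * q ^ (i + K) mod L = \<rho> j * q ^ i mod L"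
            by (simp add: cong_def)
          \<comment> \<open>Adding the odd \<open>K\<close> to the number of steps flips the sign
            and keeps the power of \<open>\<eta>\<close>.\<close>
          then have "r = (\<eta> ^ \<rho> j / c) ^ (CARD('a) ^ (if even i = s then i else i + K))"
            unfolding root_frobenius_power_sign[OF frob] r using K(1) by (auto simp: q_def)
          then show "r \<in> range (\<lambda>k. (\<eta> ^ \<rho> j / c) ^ (CARD('a) ^ k))" by blast
        qed
      qed (use disjoint in auto)
      then show ?thesis
        using \<beta>1 \<iota>b
        by (simp add: monic_assoc_scale_mult monic_assoc_scale_Mpoly monic_assoc_scale_roots_coset c_def
            Ball_def)
    qed

    \<comment> \<open>Even order: each orbit pairs a half coset with a sign\<close>
    have B2: "\<exists>\<epsilon>0::nat. \<exists>\<epsilon> \<epsilon>' :: nat \<Rightarrow> nat. \<epsilon>0 \<le> p ^ n \<and>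
             (\<forall>i\<in>{1..e}. \<epsilon> i \<le> p ^ n \<and> \<epsilon>' i \<le> p ^ n) \<and>
             gen_by \<iota> lam N C
               (monic_assoc (scale_var ([:- inverse \<beta>1, 1:] * [:inverse \<beta>1, 1:]) (\<iota> b)) ^ \<epsilon>0 *
                (\<Prod>i\<in>{1..e}.
                  monic_assoc (scale_var
                    (monic_assoc (scale_var (Npoly q L \<eta> (\<rho> i)) \<beta>1) *
                     monic_assoc (scale_var (Npoly q L \<eta> (\<rho> i * q)) (- \<beta>1)))
                    (\<iota> b)) ^ \<epsilon> i *
                  monic_assoc (scale_var
                    (monic_assoc (scale_var (Npoly q L \<eta> (\<rho> i * q)) \<beta>1) *
                     monic_assoc (scale_var (Npoly q L \<eta> (\<rho> i)) (- \<beta>1)))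
                    (\<iota> b)) ^ \<epsilon>' i))" if ord: "even (ord l q)"
    proof -
      define D where "D t = cyc_coset (q\<^sup>2) L t" for t
      \<comment> \<open>For i at least 1, \<open>True\<close> stands for the block of Q_i and
        \<open>False\<close> for that of R_i.\<close>
      define S where "S = (\<lambda>(i, s). if s then D (\<rho> i) else D (\<rho> i * q))"
      define T where "T = (\<lambda>(i, s). if s then D (\<rho> i * q) else D (\<rho> i))"
      \<comment> \<open>The pair \<open>(0, False)\<close> is left out: both halves of the coset of
        0 are {0}, so it would repeat the block of \<open>(0, True)\<close>.\<close>
      define J where "J = insert (0, True) ({1..e} \<times> (UNIV :: bool set))"
      have coset: "cyc_coset q L t = D t \<union> D (t * q)" for t
        unfolding D_def by (rule cyc_coset_split)
      have D0: "D (\<rho> 0) = {0}" "D (\<rho> 0 * q) = {0}"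
        by (simp_all add: D_def \<rho>0 cyc_coset_0)
      have D_disjoint: "D (\<rho> i) \<inter> D (\<rho> i * q) = {}" if i: "i \<in> {1..e}" for i
      proof -
        have "\<rho> i \<noteq> 0"
        proof
          assume "\<rho> i = 0"
          then have "cyc_coset q L (\<rho> i) = cyc_coset q L (\<rho> 0)" by (simp add: \<rho>0)
          then have "i = 0" using i by (intro inj_onD[OF \<rho>_distinct]) auto
          then show False using i by simp
        qed
        moreover have "\<rho> i < L" using \<rho>_range i by simp
        ultimately have "\<not> l ^ m dvd \<rho> i" using nat_dvd_not_less by (simp add: L_def)
        then show ?thesis
          unfolding D_def L_def by (rule cyc_coset_square_disjoint[OF l_prime coprime_l ord])
      qed
      have range_split: "{0..e} = insert 0 {1..e}" by auto
      have cover': "(\<Union>j\<in>J. S j) = {..<L}" "(\<Union>j\<in>J. T j) = {..<L}"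
        unfolding cover[symmetric] coset range_split J_def UN_insert UN_times_bool
        by (simp_all add: S_def T_def D0 Un_commute)
      have sub: "S (i, s) \<subseteq> cyc_coset q L (\<rho> i)" "T (i, s) \<subseteq> cyc_coset q L (\<rho> i)" for i s
        unfolding coset by (auto simp: S_def T_def)
      \<comment> \<open>An even number of steps keeps \<open>d\<close> and runs through the
        q^2-coset of t; an odd number negates \<open>d\<close> and runs through that of tq.\<close>
      have orbit: "roots (D t) d \<union> roots (D (t * q)) (- d) \<subseteq> range (\<lambda>k. (\<eta> ^ t / d) ^ (CARD('a) ^ k))"
        if d: "d ^ CARD('a) = - d" for t d
      proof
        fix r assume "r \<in> roots (D t) d \<union> roots (D (t * q)) (- d)"
        then consider i where "r = \<eta> ^ (t * (q\<^sup>2) ^ i mod L) / d"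
          | i where "r = \<eta> ^ (t * q * (q\<^sup>2) ^ i mod L) / (- d)"
          by (auto simp only: roots_def D_def cyc_coset_def)
        then show "r \<in> range (\<lambda>k. (\<eta> ^ t / d) ^ (CARD('a) ^ k))"
        proof cases
          case 1
          then have "r = (\<eta> ^ t / d) ^ (CARD('a) ^ (2 * i))"
            unfolding root_frobenius_power_sign[OF d] by (simp add: q_def power_mult)
          then show ?thesis by blast
        next
          case 2
          then have "r = (\<eta> ^ t / d) ^ (CARD('a) ^ (2 * i + 1))"
            unfolding root_frobenius_power_sign[OF d] by (simp add: q_def power_mult mult.assoc)
          then show ?thesis by blast
        qed
      qed
      have "\<exists>\<epsilon>. (\<forall>j\<in>J. \<epsilon> j \<le> p ^ n) \<and> gen_by \<iota> lam N C
        (\<Prod>j\<in>J. (root_poly (roots (S j) c) * root_poly (roots (T j) (- c))) ^ \<epsilon> j)"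
      proof (rule signed_orbit_generator[OF C_code c N(2,1) c_pow _ cover'])
        show "finite J" by (simp add: J_def)
        show "S i \<inter> S j = {} \<and> T i \<inter> T j = {}" if ij: "i \<in> J" "j \<in> J" "i \<noteq> j" for i j
        proof -
          obtain i' s j' t where eq: "i = (i', s)" "j = (j', t)" by (cases i, cases j)
          show ?thesis
          proof (cases "i' = j'")
            case False
            have "i' \<le> e" "j' \<le> e" using ij by (auto simp: eq J_def)
            then show ?thesis
              using disjoint[of i' j'] False sub[of i' s] sub[of j' t] unfolding eq by blast
          next
            case True
            then have "i' \<in> {1..e}" "s \<noteq> t" using ij by (auto simp: eq J_def)
            then show ?thesis
              using D_disjoint[of i'] True by (auto simp: eq S_def T_def)
          qed
        qed
        show "\<exists>x. roots (S j) c \<union> roots (T j) (- c) \<subseteq> range (\<lambda>k. x ^ (CARD('a) ^ k))" for j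
        proof (cases j)
          case (Pair i s)
          show ?thesis
          proof (cases s)
            case True
            then show ?thesis
              using orbit[OF frob, of "\<rho> i"] by (intro exI) (simp add: Pair S_def T_def)
          next
            \<comment> \<open>Starting the orbit at parameter -c instead of c exchanges the roles of
              the two halves.\<close>
            case False
            then show ?thesis
              using orbit[OF frob', of "\<rho> i"]
              by (intro exI[of _ "\<eta> ^ \<rho> i / (- c)"]) (simp add: Pair S_def T_def)
          qed
        qed
      qed
      then obtain \<epsilon> where \<epsilon>: "\<forall>j\<in>J. \<epsilon> j \<le> p ^ n" and gen: "gen_by \<iota> lam N C
        (\<Prod>j\<in>J. (root_poly (roots (S j) c) * root_poly (roots (T j) (- c))) ^ \<epsilon> j)"
        by blast
      define F where "F j = root_poly (roots (S j) c) * root_poly (roots (T j) (- c))" for j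
      \<comment> \<open>The only exponent of \<open>\<eta>\<close> is 0, so the roots are the
        inverse of \<open>c\<close> and its negative, which are those of P(bX).\<close>
      have F0: "F (0, True) = monic_assoc (scale_var ([:- inverse \<beta>1, 1:] * [:inverse \<beta>1, 1:]) (\<iota> b))"
      proof -
        have "[:- inverse \<beta>1, 1:] = root_poly (roots {0} \<beta>1)" "[:inverse \<beta>1, 1:] = root_poly (roots {0} (- \<beta>1))"
          by (simp_all add: root_poly_def roots_def inverse_eq_divide)
        then show ?thesis
          using \<iota>b L_pos
          by (simp only: monic_assoc_scale_mult) (simp add: F_def S_def T_def D0 monic_assoc_scale_roots c_def)
      qed
      have F1: "F (i, True) = monic_assoc (scale_var
                    (monic_assoc (scale_var (Npoly q L \<eta> (\<rho> i)) \<beta>1) *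
                     monic_assoc (scale_var (Npoly q L \<eta> (\<rho> i * q)) (- \<beta>1))) (\<iota> b))"
        "F (i, False) = monic_assoc (scale_var
                    (monic_assoc (scale_var (Npoly q L \<eta> (\<rho> i * q)) \<beta>1) *
                     monic_assoc (scale_var (Npoly q L \<eta> (\<rho> i)) (- \<beta>1))) (\<iota> b))" for i
        using \<beta>1 \<iota>b
        by (simp_all add: F_def S_def T_def D_def monic_assoc_scale_mult monic_assoc_scale_Npoly
            monic_assoc_scale_roots_coset c_def)
      have "(\<Prod>j\<in>J. F j ^ \<epsilon> j) = F (0, True) ^ \<epsilon> (0, True) *
        (\<Prod>i\<in>{1..e}. \<Prod>s\<in>UNIV. F (i, s) ^ \<epsilon> (i, s))"
        unfolding J_def by (subst prod.insert) (simp_all add: prod.cartesian_product)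
      also have "\<dots> = F (0, True) ^ \<epsilon> (0, True) *
        (\<Prod>i\<in>{1..e}. F (i, True) ^ \<epsilon> (i, True) * F (i, False) ^ \<epsilon> (i, False))"
        by (simp add: UNIV_bool mult.commute)
      finally have "gen_by \<iota> lam N C (F (0, True) ^ \<epsilon> (0, True) *
        (\<Prod>i\<in>{1..e}. F (i, True) ^ \<epsilon> (i, True) * F (i, False) ^ \<epsilon> (i, False)))"
        using gen by (simp only: F_def)
      moreover have "\<epsilon> (0, True) \<le> p ^ n" "\<forall>i\<in>{1..e}. \<epsilon> (i, True) \<le> p ^ n \<and> \<epsilon> (i, False) \<le> p ^ n"
        using \<epsilon> by (simp_all add: J_def)
      ultimately show ?thesis
        unfolding F0[symmetric] F1[symmetric]
        by - (rule exI[of _ "\<epsilon> (0, True)"], rule exI[of _ "\<lambda>i. \<epsilon> (i, True)"],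
          rule exI[of _ "\<lambda>i. \<epsilon> (i, False)"], intro conjI)
    qed
    show "\<exists>b::'a. b \<noteq> 0 \<and> b ^ N * lam = \<xi> ^ (p ^ n) \<and>
         (odd (ord l q) \<longrightarrow>
           (\<exists>\<epsilon> :: nat \<Rightarrow> nat. (\<forall>i\<le>e. \<epsilon> i \<le> p ^ n) \<and>
             gen_by \<iota> lam N C
               (\<Prod>i\<in>{0..e}.
                  monic_assoc (scale_var
                    (monic_assoc (scale_var (Mpoly q L \<eta> (\<rho> i)) \<beta>1) *
                     monic_assoc (scale_var (Mpoly q L \<eta> (\<rho> i)) (- \<beta>1)))
                    (\<iota> b)) ^ \<epsilon> i))) \<and>
         (even (ord l q) \<longrightarrow>
           (\<exists>\<epsilon>0::nat. \<exists>\<epsilon> \<epsilon>' :: nat \<Rightarrow> nat. \<epsilon>0 \<le> p ^ n \<and>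
             (\<forall>i\<in>{1..e}. \<epsilon> i \<le> p ^ n \<and> \<epsilon>' i \<le> p ^ n) \<and>
             gen_by \<iota> lam N C
               (monic_assoc (scale_var ([:- inverse \<beta>1, 1:] * [:inverse \<beta>1, 1:]) (\<iota> b)) ^ \<epsilon>0 *
                (\<Prod>i\<in>{1..e}.
                  monic_assoc (scale_var
                    (monic_assoc (scale_var (Npoly q L \<eta> (\<rho> i)) \<beta>1) *
                     monic_assoc (scale_var (Npoly q L \<eta> (\<rho> i * q)) (- \<beta>1)))
                    (\<iota> b)) ^ \<epsilon> i *
                  monic_assoc (scale_var
                    (monic_assoc (scale_var (Npoly q L \<eta> (\<rho> i * q)) \<beta>1) *
                     monic_assoc (scale_var (Npoly q L \<eta> (\<rho> i)) (- \<beta>1)))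
                    (\<iota> b)) ^ \<epsilon>' i))))"
      using b(1) b_pow B1 B2 by blast
  qed
qed

end
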